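(* Let $\mathbb{V}$ be a game mapping that satisfies the dynamic programming principle on $\mathfrak{D}$, let $\mathcal{V}[\varrho]:=\mathbb{V}\big[c[\varrho]\big]$ for $\varrho\in\mathfrak{D}$, and let $U_*:\Omega\to[0,1]$ be an arbitrary function. Then the following conditions are equivalent: (c) for every density $\mu\in\mathfrak{D}$ that is piecewise continuous on $(0,\infty)$, $\lim_{\lambda\to+0}\sup_{\omega\in\Omega}\big|\mathcal{V}[\mu^\lambda_{\mathrm{scale}}](\omega)-U_*(\omega)\big|=0$; (u) $\lim_{T\to+\infty}\sup_{\omega\in\Omega}\big|\mathcal{V}[\varpi_T](\omega)-U_*(\omega)\big|=0$; (e) $\lim_{\lambda\to+0}\sup_{\omega\in\Omega}\big|\mathcal{V}[\pi_\lambda](\omega)-U_*(\omega)\big|=0$; (p) for some power density $\varrho\in\mathfrak{D}$, $\lim_{T\to+\infty}\sup_{\omega\in\Omega}\big|\mathcal{V}[\varrho^T_{\mathrm{shift}}](\omega)-U_*(\omega)\big|=0$; (q) for every power density $\varrho\in\mathfrak{D}$, $\lim_{T\to+\infty}\sup_{\omega\in\Omega}\big|\mathcal{V}[\varrho^T_{\mathrm{shift}}](\omega)-U_*(\omega)\big|=0$. In particular, if for some density $\mu\in\mathfrak{D}$ piecewise continuous on $(0,\infty)$ and some power density $\varrho\in\mathfrak{D}$ at least one of the first three limits among $\lim_{T\to+\infty}\mathcal{V}[\varpi_T]$, $\lim_{\lambda\to+0}\mathcal{V}[\pi_\lambda]$, $\lim_{T\to+\infty}\mathcal{V}[\varrho^T_{\mathrm{shift}}]$,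 $\lim_{\lambda\to+0}\mathcal{V}[\mu^\lambda_{\mathrm{scale}}]$ exists and is uniform on $\Omega$, then all four of these limits exist, are uniform on $\Omega$, coincide, and do not depend on the choice of such $\mu$ and $\varrho$.
   Context: $\mathbb{R}_+=[0,\infty)$. Fix a nonempty set $\Omega$, a nonempty set $\mathbb{K}$ of maps $\mathbb{R}_+\to\Omega$, and a map $g:\Omega\to[0,1]$ such that $t\mapsto g(z(t))$ is Lebesgue measurable for every $z\in\mathbb{K}$. Let $\mathfrak{C}$ be the set of all bounded maps $\mathbb{K}\to\mathbb{R}$ and $\mathfrak{U}$ the set of all bounded maps $\Omega\to\mathbb{R}$. A game mapping is a map $\mathbb{V}:\mathfrak{C}\to\mathfrak{U}$ such that $\mathbb{V}[Ac+B]=A\mathbb{V}[c]+B$ for all $c\in\mathfrak{C}$, $A\ge0$, $B\in\mathbb{R}$, and such that $c_1(z)\le c_2(z)$ for all $z\in\mathbb{K}$ implies $\mathbb{V}[c_1](\omega)\le\mathbb{V}[c_2](\omega)$ for all $\omega\in\Omega$. $\mathfrak{D}$ is the set of probability densities supported in $\mathbb{R}_+$ (Lebesgue integrable $\varrho:\mathbb{R}_+\to\mathbb{R}_+$ with $\int_0^\infty\varrho=1$). For $\varrho\in\mathfrak{D}$ and $T>0$ with $\int_T^\infty\varrho(t)dt>0$, $\varrho^T_{\mathrm{shift}}(t):=\varrho(t+T)/\int_T^\infty\varrho(s)ds$; for $\lambda>0$, $\varrho^\lambda_{\mathrm{scale}}(t):=\lambda\varrho(\lambda t)$. For $\varrho\in\mathfrak{D}$,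 $c[\varrho](z):=\int_0^\infty\varrho(t)g(z(t))dt$, $z\in\mathbb{K}$. For $\varrho\in\mathfrak{D}$, $T>0$ with $\int_T^\infty\varrho>0$, define $d[\varrho,T](z):=\int_0^T\varrho(t)g(z(t))dt+\int_T^\infty\varrho(t)dt\cdot\mathbb{V}\big[c[\varrho^T_{\mathrm{shift}}]\big](z(T))$. $\mathbb{V}$ satisfies the dynamic programming principle on $\mathfrak{D}$ if $\mathbb{V}[d[\varrho,T]]=\mathbb{V}[c[\varrho]]$ for all $\varrho\in\mathfrak{D}$, $T>0$ with $\int_T^\infty\varrho>0$. Densities: $\varpi_T(t)=\frac1T1_{[0,T]}(t)$, $\pi_\lambda(t)=\lambda e^{-\lambda t}$ ($T,\lambda>0$). A density $\varrho\in\mathfrak{D}$ is a power density if $\varrho(t)=(\alpha+\beta t)^{-\gamma}$ for all $t\ge0$ for some $\alpha,\beta,\gamma>0$. *)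

theory Defs
  imports "HOL-Analysis.Analysis"
begin

text \<open>Omega is the type 'w; the set of trajectories K is a set of maps real => 'w
  (only their values on [0,oo) matter).  Bounded maps K -> R are represented by
  functions on (real => 'w) that are bounded on K.\<close>

definition game_mapping ::
  "(real \<Rightarrow> 'w) set \<Rightarrow> (((real \<Rightarrow> 'w) \<Rightarrow> real) \<Rightarrow> 'w \<Rightarrow> real) \<Rightarrow> bool" where
  "game_mapping K V \<longleftrightarrow>
     (\<forall>c. bounded (c ` K) \<longrightarrow> bounded (range (V c))) \<and>
     (\<forall>c A B. bounded (c ` K) \<and> A \<ge> 0 \<longrightarrow>
        V (\<lambda>z. A * c z + B) = (\<lambda>\<omega>. A * V c \<omega> + B)) \<and>
     (\<forall>c1 c2. bounded (c1 ` K) \<and> bounded (c2 ` K) \<and> (\<forall>z\<in>K. c1 z \<le> c2 z) \<longrightarrow>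
        (\<forall>\<omega>. V c1 \<omega> \<le> V c2 \<omega>))"

text \<open>Probability densities supported in [0,oo) (values at negative arguments are irrelevant).\<close>
definition is_density :: "(real \<Rightarrow> real) \<Rightarrow> bool" where
  "is_density \<rho> \<longleftrightarrow> (\<forall>t\<ge>0. \<rho> t \<ge> 0) \<and> set_integrable lebesgue {0..} \<rho> \<and>
     (LINT t:{0..}|lebesgue. \<rho> t) = 1"

definition tail :: "(real \<Rightarrow> real) \<Rightarrow> real \<Rightarrow> real" where
  "tail \<rho> T = (LINT t:{T..}|lebesgue. \<rho> t)"

definition shift :: "(real \<Rightarrow> real) \<Rightarrow> real \<Rightarrow> real \<Rightarrow> real" where
  "shift \<rho> T = (\<lambda>t. \<rho> (t + T) / tail \<rho> T)"

definition scale :: "(real \<Rightarrow> real) \<Rightarrow> real \<Rightarrow> real \<Rightarrow> real" where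
  "scale \<rho> l = (\<lambda>t. l * \<rho> (l * t))"

definition cost :: "('w \<Rightarrow> real) \<Rightarrow> (real \<Rightarrow> real) \<Rightarrow> (real \<Rightarrow> 'w) \<Rightarrow> real" where
  "cost g \<rho> = (\<lambda>z. LINT t:{0..}|lebesgue. \<rho> t * g (z t))"

definition dcost ::
  "('w \<Rightarrow> real) \<Rightarrow> (((real \<Rightarrow> 'w) \<Rightarrow> real) \<Rightarrow> 'w \<Rightarrow> real) \<Rightarrow> (real \<Rightarrow> real) \<Rightarrow> real
     \<Rightarrow> (real \<Rightarrow> 'w) \<Rightarrow> real" where
  "dcost g V \<rho> T = (\<lambda>z. (LINT t:{0..T}|lebesgue. \<rho> t * g (z t))
                         + tail \<rho> T * V (cost g (shift \<rho> T)) (z T))"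

definition DPP ::
  "('w \<Rightarrow> real) \<Rightarrow> (((real \<Rightarrow> 'w) \<Rightarrow> real) \<Rightarrow> 'w \<Rightarrow> real) \<Rightarrow> bool" where
  "DPP g V \<longleftrightarrow> (\<forall>\<rho> T. is_density \<rho> \<and> T > 0 \<and> tail \<rho> T > 0 \<longrightarrow>
                     V (dcost g V \<rho> T) = V (cost g \<rho>))"

definition val ::
  "('w \<Rightarrow> real) \<Rightarrow> (((real \<Rightarrow> 'w) \<Rightarrow> real) \<Rightarrow> 'w \<Rightarrow> real) \<Rightarrow> (real \<Rightarrow> real) \<Rightarrow> 'w \<Rightarrow> real" where
  "val g V \<rho> = V (cost g \<rho>)"

definition unif_avg :: "real \<Rightarrow> real \<Rightarrow> real" where
  "unif_avg T = (\<lambda>t. indicator {0..T} t / T)"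

definition expd :: "real \<Rightarrow> real \<Rightarrow> real" where
  "expd l = (\<lambda>t. l * exp (- l * t))"

definition power_density :: "(real \<Rightarrow> real) \<Rightarrow> bool" where
  "power_density \<rho> \<longleftrightarrow> is_density \<rho> \<and>
     (\<exists>\<alpha> \<beta> \<gamma>::real. \<alpha> > 0 \<and> \<beta> > 0 \<and> \<gamma> > 0 \<and> (\<forall>t\<ge>0. \<rho> t = (\<alpha> + \<beta> * t) powr (- \<gamma>)))"

definition pw_continuous_pos :: "(real \<Rightarrow> real) \<Rightarrow> bool" where
  "pw_continuous_pos f \<longleftrightarrow>
     (\<forall>a b. 0 < a \<and> a < b \<longrightarrow> (\<exists>S. finite S \<and> (\<forall>x\<in>{a..b} - S. isCont f x))) \<and>
     (\<forall>x>0. (\<exists>l. (f \<longlongrightarrow> l) (at_left x)) \<and> (\<exists>l. (f \<longlongrightarrow> l) (at_right x)))"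

definition unif_lim :: "'s filter \<Rightarrow> ('s \<Rightarrow> 'w \<Rightarrow> real) \<Rightarrow> ('w \<Rightarrow> real) \<Rightarrow> bool" where
  "unif_lim F f U \<longleftrightarrow> ((\<lambda>s. SUP \<omega>. \<bar>f s \<omega> - U \<omega>\<bar>) \<longlongrightarrow> 0) F"

end

theory Submission
  imports Defs
begin

text \<open>
  A game mapping is nonexpansive for the supremum norm, so \<open>val g V\<close> is nonexpansive for the \<open>L\<^sup>1\<close>
  distance of densities. Uniform averages, exponential densities and shifts of power densities are all
  rescalings of a fixed density \<open>\<mu>\<close>, and each such \<open>\<mu>\<close> is self-similar: a shift of \<open>\<mu>\<close> is a
  rescaling of \<open>\<mu>\<close>. If the values of the rescalings of \<open>\<mu>\<close> converge uniformly to \<open>U\<close>, apply dynamic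
  programming at the time \<open>T\<close> at which \<open>\<mu>\<close> has used up mass \<open>h\<close>. Since \<open>\<mu>\<close> is constant on that initial
  piece up to an \<open>L\<^sup>1\<close> error \<open>C h\<^sup>2\<close>, the value of the payoff
  ``\<open>h\<close> times the mean of \<open>g\<close> over \<open>[0,T]\<close> plus \<open>(1 - h) U(z(T))\<close>'' differs from \<open>U\<close> by at most
  \<open>C h\<^sup>2 + o(1)\<close>.

  Cutting a uniform average into \<open>N\<close> equal pieces and iterating this with \<open>h = 1/N, 1/(N-1), \<dots>\<close>, the
  error on the \<open>k\<close>-th piece enters with weight at most \<open>(N-k)/N\<close>, so the total error is of order
  \<open>C ln N / N\<close> and the uniform averages converge to \<open>U\<close>. For uniform averages \<open>C = 0\<close>; hence the same
  iteration works for every step density, and by cell averaging and Scheffe's lemma step densities are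
  \<open>L\<^sup>1\<close>-dense among the piecewise continuous ones.
\<close>

section \<open>Densities\<close>

lemma set_integrable_scale:
  fixes f :: "real \<Rightarrow> real"
  assumes "l > 0" "set_integrable lebesgue A f" "\<And>t. t \<in> B \<longleftrightarrow> l * t \<in> A"
  shows "set_integrable lebesgue B (\<lambda>t. l * f (l * t))"
proof -
  have "integrable lebesgue (\<lambda>t. indicator A (0 + l * t) *\<^sub>R f (0 + l * t))"
    using assms(1,2) unfolding set_integrable_def
    by (subst lebesgue_integrable_real_affine_iff[of l "\<lambda>t. indicator A t *\<^sub>R f t" 0]) auto
  moreover have "indicator A (0 + l * t) = (indicator B t :: real)" for t
    using assms(3) by (auto simp: indicator_def)
  ultimately have "set_integrable lebesgue B (\<lambda>t. f (l * t))"
    by (simp add: set_integrable_def)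
  then show ?thesis by simp
qed

lemma set_integral_scale:
  fixes f :: "real \<Rightarrow> real"
  assumes "l > 0" "\<And>t. t \<in> B \<longleftrightarrow> l * t \<in> A"
  shows "(LINT t:B|lebesgue. l * f (l * t)) = (LINT t:A|lebesgue. f t)"
proof -
  have "(LINT t:A|lebesgue. f t)
      = l * (LINT t|lebesgue. indicator A (0 + l * t) *\<^sub>R f (0 + l * t))"
    using assms(1) unfolding set_lebesgue_integral_def
    by (subst lebesgue_integral_real_affine[of l "\<lambda>t. indicator A t *\<^sub>R f t" 0]) auto
  moreover have "indicator A (0 + l * t) = (indicator B t :: real)" for t
    using assms(2) by (auto simp: indicator_def)
  ultimately have "(LINT t:A|lebesgue. f t) = l * (LINT t:B|lebesgue. f (l * t))"
    by (simp add: set_lebesgue_integral_def)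
  then show ?thesis by simp
qed

lemma set_integrable_shift:
  fixes f :: "real \<Rightarrow> real"
  assumes "set_integrable lebesgue A f" "\<And>t. t \<in> B \<longleftrightarrow> t + s \<in> A"
  shows "set_integrable lebesgue B (\<lambda>t. f (t + s))"
proof -
  have "integrable lebesgue (\<lambda>t. indicator A (s + 1 * t) *\<^sub>R f (s + 1 * t))"
    using assms(1) unfolding set_integrable_def
    by (subst lebesgue_integrable_real_affine_iff[of 1 "\<lambda>t. indicator A t *\<^sub>R f t" s]) auto
  moreover have "indicator A (s + 1 * t) = (indicator B t :: real)" for t
    using assms(2) by (auto simp: indicator_def add.commute)
  ultimately show ?thesis
    by (simp add: set_integrable_def add.commute)
qed

lemma set_integral_shift:
  fixes f :: "real \<Rightarrow> real"
  assumes "\<And>t. t \<in> B \<longleftrightarrow> t + s \<in> A"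
  shows "(LINT t:B|lebesgue. f (t + s)) = (LINT t:A|lebesgue. f t)"
proof -
  have "(LINT t:A|lebesgue. f t)
      = (LINT t|lebesgue. indicator A (s + 1 * t) *\<^sub>R f (s + 1 * t))"
    unfolding set_lebesgue_integral_def
    by (subst lebesgue_integral_real_affine[of 1 "\<lambda>t. indicator A t *\<^sub>R f t" s]) auto
  moreover have "indicator A (s + 1 * t) = (indicator B t :: real)" for t
    using assms by (auto simp: indicator_def add.commute)
  ultimately show ?thesis
    by (simp add: set_lebesgue_integral_def add.commute)
qed

text \<open>A single point is null, so an endpoint may be included or dropped freely when intervals
  are cut and joined.\<close>

lemma set_integral_null_symdiff:
  fixes f :: "real \<Rightarrow> real"
  assumes "(A - B) \<union> (B - A) \<subseteq> {c}"
  shows "(LINT t:A|lebesgue. f t) = (LINT t:B|lebesgue. f t)"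
  by (rule set_integral_discrete_difference[where X = "{c}"])
     (use assms in \<open>auto simp: emeasure_lborel_singleton\<close>)

lemma set_integral_nonneg_mono_set:
  fixes f :: "real \<Rightarrow> real"
  assumes "set_integrable lebesgue B f" "A \<subseteq> B" "A \<in> sets lebesgue" "\<And>t. t \<in> B \<Longrightarrow> f t \<ge> 0"
  shows "(LINT t:A|lebesgue. f t) \<le> (LINT t:B|lebesgue. f t)"
  unfolding set_lebesgue_integral_def
proof (rule integral_mono)
  show "integrable lebesgue (\<lambda>x. indicat_real A x *\<^sub>R f x)"
    using set_integrable_subset[OF assms(1) assms(3,2)] by (simp add: set_integrable_def)
qed (use assms in \<open>auto simp: set_integrable_def indicator_def\<close>)

lemma set_integral_split_at:
  fixes f :: "real \<Rightarrow> real"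
  assumes "set_integrable lebesgue {a..} f" "a \<le> b"
  shows "(LINT t:{a..}|lebesgue. f t) = (LINT t:{a..b}|lebesgue. f t) + (LINT t:{b..}|lebesgue. f t)"
proof -
  have "{a..} = {a..b} \<union> {b<..}" using assms(2) by auto
  moreover have "(LINT t:{a..b} \<union> {b<..}|lebesgue. f t)
      = (LINT t:{a..b}|lebesgue. f t) + (LINT t:{b<..}|lebesgue. f t)"
    by (rule set_integral_Un) (use assms in \<open>auto intro: set_integrable_subset\<close>)
  moreover have "(LINT t:{b<..}|lebesgue. f t) = (LINT t:{b..}|lebesgue. f t)"
    by (rule set_integral_null_symdiff[where c = b]) auto
  ultimately show ?thesis by simp
qed

section \<open>Densities, their tails, rescalings and shifts\<close>

lemma is_densityD:
  assumes "is_density \<rho>"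
  shows "t \<ge> 0 \<Longrightarrow> \<rho> t \<ge> 0" "set_integrable lebesgue {0..} \<rho>" "(LINT t:{0..}|lebesgue. \<rho> t) = 1"
  using assms by (auto simp: is_density_def)

lemma density_integrable_on:
  assumes "is_density \<rho>" "A \<subseteq> {0..}" "A \<in> sets lebesgue"
  shows "set_integrable lebesgue A \<rho>"
  using assms set_integrable_subset is_densityD(2) by blast

lemma tail_nonneg: "is_density \<rho> \<Longrightarrow> s \<ge> 0 \<Longrightarrow> tail \<rho> s \<ge> 0"
  unfolding tail_def set_lebesgue_integral_def
  by (rule integral_nonneg_AE) (auto simp: indicator_def is_densityD)

lemma tail_antimono: "is_density \<rho> \<Longrightarrow> 0 \<le> s \<Longrightarrow> s \<le> t \<Longrightarrow> tail \<rho> t \<le> tail \<rho> s"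
  unfolding tail_def
  by (rule set_integral_nonneg_mono_set) (auto intro!: density_integrable_on simp: is_densityD)

lemma tail_0: "is_density \<rho> \<Longrightarrow> tail \<rho> 0 = 1"
  by (simp add: tail_def is_densityD)

lemma tail_le_1: "is_density \<rho> \<Longrightarrow> s \<ge> 0 \<Longrightarrow> tail \<rho> s \<le> 1"
  using tail_antimono[of \<rho> 0 s] tail_0 by simp

lemma head_eq:
  assumes "is_density \<rho>" "s \<ge> 0"
  shows "(LINT t:{0..s}|lebesgue. \<rho> t) = 1 - tail \<rho> s"
  using set_integral_split_at[of 0 \<rho> s] assms by (simp add: is_densityD tail_def)

lemma tail_tendsto_0:
  assumes "is_density \<rho>"
  shows "(tail \<rho> \<longlongrightarrow> 0) at_top"
proof -
  have "((\<lambda>s. LINT t:{0..s}|lebesgue. \<rho> t) \<longlongrightarrow> (LINT t:{0..}|lebesgue. \<rho> t)) at_top"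
    using assms by (intro tendsto_set_lebesgue_integral_at_top) (auto simp: is_densityD)
  then have "((\<lambda>s. 1 - (LINT t:{0..s}|lebesgue. \<rho> t)) \<longlongrightarrow> 1 - 1) at_top"
    using assms by (intro tendsto_intros) (simp add: is_densityD)
  then show ?thesis
    by (simp, elim Lim_transform_eventually)
       (use eventually_ge_at_top[of 0] in eventually_elim, simp add: head_eq assms)
qed

lemma is_density_scale:
  assumes "is_density \<rho>" "l > 0"
  shows "is_density (scale \<rho> l)"
  unfolding is_density_def scale_def
proof (intro conjI)
  show "set_integrable lebesgue {0..} (\<lambda>t. l * \<rho> (l * t))"
    by (rule set_integrable_scale[where A = "{0..}"])
       (use assms in \<open>auto simp: is_densityD zero_le_mult_iff\<close>)
  show "(LINT t:{0..}|lebesgue. l * \<rho> (l * t)) = 1"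
    by (subst set_integral_scale[where A = "{0..}"])
       (use assms in \<open>auto simp: is_densityD zero_le_mult_iff\<close>)
qed (use assms in \<open>auto simp: is_densityD\<close>)

lemma tail_scale:
  assumes "l > 0"
  shows "tail (scale \<rho> l) T = tail \<rho> (l * T)"
  unfolding tail_def scale_def
  by (rule set_integral_scale) (use assms in auto)

lemma is_density_shift:
  assumes "is_density \<rho>" "s \<ge> 0" "tail \<rho> s > 0"
  shows "is_density (shift \<rho> s)"
  unfolding is_density_def shift_def
proof (intro conjI)
  show "set_integrable lebesgue {0..} (\<lambda>t. \<rho> (t + s) / tail \<rho> s)"
    using set_integrable_shift[of "{s..}" \<rho> "{0..}" s] density_integrable_on[OF assms(1), of "{s..}"] assms
    by auto
  show "(LINT t:{0..}|lebesgue. \<rho> (t + s) / tail \<rho> s) = 1"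
    using set_integral_shift[of "{0..}" s "{s..}" \<rho>] assms by (simp add: tail_def)
qed (use assms in \<open>auto simp: is_densityD\<close>)

lemma tail_shift: "tail (shift \<rho> s) t = tail \<rho> (s + t) / tail \<rho> s"
proof -
  have "(LINT x:{t..}|lebesgue. \<rho> (x + s)) = (LINT x:{s + t..}|lebesgue. \<rho> x)"
    by (rule set_integral_shift) auto
  then have "(LINT x:{t..}|lebesgue. \<rho> (x + s) / c) = (LINT x:{s + t..}|lebesgue. \<rho> x) / c" for c
    by simp
  then show ?thesis
    unfolding shift_def tail_def by blast
qed

text \<open>Dynamic programming shifts a rescaled density. Commuting the two operations moves the
  shift onto the fixed density, whose shifts are under control.\<close>

lemma shift_scale:
  assumes "l > 0"
  shows "shift (scale \<rho> l) T = scale (shift \<rho> (l * T)) l"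
  using assms by (simp add: shift_def tail_scale) (simp add: scale_def algebra_simps)

lemma scale_scale: "scale (scale \<rho> r) l = scale \<rho> (r * l)"
  by (simp add: scale_def algebra_simps)

text \<open>\<open>F\<close> is the survival function: the fundamental theorem of calculus on
  \<open>{s..}\<close> yields all tails at once, and \<open>F 0 = 1\<close> is the total
  mass.\<close>

lemma density_antideriv:
  assumes F: "\<And>t. t \<ge> 0 \<Longrightarrow> (F has_real_derivative - f t) (at t)"
    and f: "\<And>t. t \<ge> 0 \<Longrightarrow> f t \<ge> 0" "f \<in> borel_measurable borel"
    and F0: "F 0 = 1" and lim: "(F \<longlongrightarrow> 0) at_top"
  shows "is_density f" "\<And>s. s \<ge> 0 \<Longrightarrow> tail f s = F s"
proof -
  have hb: "has_bochner_integral lebesgue (\<lambda>x. indicator {s..} x *\<^sub>R f x) (F s)" if "s \<ge> 0" for s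
  proof -
    have "(\<integral>\<^sup>+x. ennreal (f x) * indicator {s ..} x \<partial>lborel) = ennreal (0 - - F s)"
    proof (rule nn_integral_FTC_atLeast[where F = "\<lambda>x. - F x"])
      show "((\<lambda>x. - F x) has_real_derivative f x) (at x)" if "s \<le> x" for x
        using DERIV_minus[OF F[of x]] that \<open>s \<ge> 0\<close> by simp
      show "((\<lambda>x. - F x) \<longlongrightarrow> 0) at_top" using tendsto_minus[OF lim] by simp
    qed (use f that in auto)
    moreover have "ennreal (f x) * indicator {s..} x = ennreal (indicator {s..} x *\<^sub>R f x)" for x
      by (simp add: indicator_def)
    ultimately have 1: "(\<integral>\<^sup>+x. ennreal (indicator {s..} x *\<^sub>R f x) \<partial>lborel) = ennreal (F s)"
      by simp
    have mono: "F y \<le> F x" if "x \<ge> s" "y \<ge> x" for x y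
    proof (rule DERIV_nonpos_imp_nonincreasing[OF that(2)])
      fix u assume "x \<le> u" "u \<le> y"
      then have "u \<ge> 0" using that \<open>s \<ge> 0\<close> by linarith
      then show "\<exists>y. DERIV F u :> y \<and> y \<le> 0" using F f(1) by fastforce
    qed
    \<comment> \<open>\<open>F\<close> is nonincreasing with limit 0, hence nonnegative. This
      permits the passage from the integral in \<open>ennreal\<close> to a real one.\<close>
    have "F s \<ge> 0"
    proof (rule tendsto_upperbound[OF lim])
      show "\<forall>\<^sub>F i in at_top. F i \<le> F s"
        using eventually_ge_at_top[of s] by eventually_elim (use mono in auto)
    qed auto
    have "has_bochner_integral lborel (\<lambda>x. indicator {s..} x *\<^sub>R f x) (F s)"
      by (rule has_bochner_integral_nn_integral[OF _ _ _ 1])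
         (use f \<open>F s \<ge> 0\<close> that in \<open>auto simp: indicator_def\<close>)
    \<comment> \<open>Borel measurability carries the integral from \<open>lborel\<close> over to
      its completion \<open>lebesgue\<close>.\<close>
    moreover have "(\<lambda>x. indicator {s..} x *\<^sub>R f x) \<in> borel_measurable lborel"
      using f(2) by simp
    ultimately show ?thesis
      by (simp only: has_bochner_integral_iff integrable_completion integral_completion)
  qed
  show "is_density f"
    using hb[of 0] F0 f by (auto simp: is_density_def set_integrable_def set_lebesgue_integral_def has_bochner_integral_iff)
  show "tail f s = F s" if "s \<ge> 0" for s
    using hb[OF that] by (auto simp: tail_def set_lebesgue_integral_def has_bochner_integral_iff)
qed

section \<open>Values of costs\<close>

locale dpp_game =
  fixes K :: "(real \<Rightarrow> 'w) set"
    and g :: "'w \<Rightarrow> real"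
    and V :: "((real \<Rightarrow> 'w) \<Rightarrow> real) \<Rightarrow> 'w \<Rightarrow> real"
  assumes g_range: "\<And>x. 0 \<le> g x \<and> g x \<le> 1"
    and g_meas: "\<And>z. z \<in> K \<Longrightarrow> set_borel_measurable lebesgue {0..} (\<lambda>t. g (z t))"
    and game: "game_mapping K V"
    and dpp: "DPP g V"
begin

section \<open>Monotonicity and nonexpansiveness of the value\<close>

lemma V_affine: "bounded (c ` K) \<Longrightarrow> A \<ge> 0 \<Longrightarrow> V (\<lambda>z. A * c z + B) \<omega> = A * V c \<omega> + B"
  using game unfolding game_mapping_def by metis

lemma V_mono:
  "bounded (c1 ` K) \<Longrightarrow> bounded (c2 ` K) \<Longrightarrow> (\<And>z. z \<in> K \<Longrightarrow> c1 z \<le> c2 z) \<Longrightarrow> V c1 \<omega> \<le> V c2 \<omega>"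
  using game unfolding game_mapping_def by blast

text \<open>Adding \<open>e\<close> to a payoff adds \<open>e\<close> to its value, so monotonicity
  tolerates an additive error. Used in both directions this becomes nonexpansiveness for the
  supremum norm over \<open>K\<close>.\<close>

lemma V_le_add:
  assumes "bounded (c1 ` K)" "bounded (c2 ` K)" "\<And>z. z \<in> K \<Longrightarrow> c1 z \<le> c2 z + e"
  shows "V c1 \<omega> \<le> V c2 \<omega> + e"
proof -
  have "bounded ((\<lambda>z. 1 * c2 z + e) ` K)"
    using bounded_translation[OF assms(2), of e] by (simp add: image_image add.commute)
  then have "V c1 \<omega> \<le> V (\<lambda>z. 1 * c2 z + e) \<omega>"
    using assms by (intro V_mono) auto
  then show ?thesis using V_affine[OF assms(2), of 1 e \<omega>] by simp
qed

lemma V_nonexpansive: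
  assumes "bounded (c1 ` K)" "bounded (c2 ` K)" "\<And>z. z \<in> K \<Longrightarrow> \<bar>c1 z - c2 z\<bar> \<le> e"
  shows "\<bar>V c1 \<omega> - V c2 \<omega>\<bar> \<le> e"
proof -
  have "c1 z \<le> c2 z + e" "c2 z \<le> c1 z + e" if "z \<in> K" for z
    using assms(3)[OF that] by auto
  then show ?thesis
    using V_le_add[OF assms(1,2), of e \<omega>] V_le_add[OF assms(2,1), of e \<omega>] by fastforce
qed

lemma bounded_imageI: "(\<And>z. z \<in> K \<Longrightarrow> a \<le> c z \<and> c z \<le> b) \<Longrightarrow> bounded (c ` K)" for a b :: real
  by (rule bounded_subset[OF bounded_closed_interval[of a b]]) auto

lemma V_between:
  assumes "\<And>z. z \<in> K \<Longrightarrow> a \<le> c z \<and> c z \<le> b"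
  shows "a \<le> V c \<omega>" "V c \<omega> \<le> b"
proof -
  have b: "bounded (c ` K)" by (rule bounded_imageI[of a _ b]) (use assms in auto)
  \<comment> \<open>The choice \<open>A = 0\<close> in the affine rule makes the value of a constant
    payoff that constant.\<close>
  have const: "V (\<lambda>z. B) \<omega> = B" for B
    using V_affine[OF b, of 0 B \<omega>] by simp
  have "bounded ((\<lambda>z. B) ` K)" for B :: real by (rule bounded_imageI[of B _ B]) auto
  with b show "a \<le> V c \<omega>" "V c \<omega> \<le> b"
    using V_mono[of "\<lambda>z. a" c \<omega>] V_mono[of c "\<lambda>z. b" \<omega>] assms by (auto simp: const)
qed

text \<open>Since \<open>g\<close> takes values in \<open>[0,1]\<close>, the weighted integrand is
  dominated in modulus by \<open>\<phi>\<close>.\<close>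

lemma
  assumes "z \<in> K" "A \<subseteq> {0..}" "A \<in> sets lebesgue" "set_integrable lebesgue A \<phi>"
  shows weighted_payoff_integrable: "set_integrable lebesgue A (\<lambda>t. \<phi> t * g (z t))"
    and weighted_payoff_abs_le: "\<bar>LINT t:A|lebesgue. \<phi> t * g (z t)\<bar> \<le> (LINT t:A|lebesgue. \<bar>\<phi> t\<bar>)"
proof -
  have m: "(\<lambda>t. indicator {0..} t *\<^sub>R g (z t)) \<in> borel_measurable lebesgue"
    using g_meas[OF assms(1)] by (simp add: set_borel_measurable_def)
  have p: "(\<lambda>t. indicator A t *\<^sub>R \<phi> t) \<in> borel_measurable lebesgue"
    using assms(4) by (auto simp: set_integrable_def)
  \<comment> \<open>The payoff rate is only known to be measurable on the half-line. As
    \<open>A\<close> lies inside it, the indicator of \<open>{0..}\<close> can be inserted without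
    changing the integrand.\<close>
  have eq: "(\<lambda>t. indicator A t *\<^sub>R (\<phi> t * g (z t)))
      = (\<lambda>t. (indicator A t *\<^sub>R \<phi> t) * (indicator {0..} t *\<^sub>R g (z t)))"
    using assms(2) by (auto simp: indicator_def fun_eq_iff)
  have mm: "(\<lambda>t. indicator A t *\<^sub>R (\<phi> t * g (z t))) \<in> borel_measurable lebesgue"
    unfolding eq using m p by (intro borel_measurable_times)
  have le: "\<bar>\<phi> t * g (z t)\<bar> \<le> \<bar>\<phi> t\<bar>" for t
    using g_range[of "z t"] by (simp add: abs_mult mult_left_le)
  show int: "set_integrable lebesgue A (\<lambda>t. \<phi> t * g (z t))"
    by (rule set_integrable_bound[OF assms(4)])
       (use mm le in \<open>auto simp: set_borel_measurable_def\<close>)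
  have "\<bar>LINT t:A|lebesgue. \<phi> t * g (z t)\<bar> \<le> (LINT t:A|lebesgue. \<bar>\<phi> t * g (z t)\<bar>)"
    using integral_abs_bound[of lebesgue "\<lambda>t. indicator A t *\<^sub>R (\<phi> t * g (z t))"]
    by (simp add: set_lebesgue_integral_def abs_mult)
  also have "\<dots> \<le> (LINT t:A|lebesgue. \<bar>\<phi> t\<bar>)"
    using int assms(4) le by (intro set_integral_mono) (auto intro: set_integrable_abs)
  finally show "\<bar>LINT t:A|lebesgue. \<phi> t * g (z t)\<bar> \<le> (LINT t:A|lebesgue. \<bar>\<phi> t\<bar>)" .
qed

lemma weighted_payoff_bounds:
  assumes "z \<in> K" "A \<subseteq> {0..}" "A \<in> sets lebesgue" "set_integrable lebesgue A \<phi>"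
    and "\<And>t. t \<in> A \<Longrightarrow> \<phi> t \<ge> 0"
  shows "0 \<le> (LINT t:A|lebesgue. \<phi> t * g (z t))"
    "(LINT t:A|lebesgue. \<phi> t * g (z t)) \<le> (LINT t:A|lebesgue. \<phi> t)"
proof -
  show "0 \<le> (LINT t:A|lebesgue. \<phi> t * g (z t))"
    unfolding set_lebesgue_integral_def
    by (rule integral_nonneg_AE) (use assms(5) g_range in \<open>auto simp: indicator_def\<close>)
  show "(LINT t:A|lebesgue. \<phi> t * g (z t)) \<le> (LINT t:A|lebesgue. \<phi> t)"
    by (rule set_integral_mono[OF weighted_payoff_integrable[OF assms(1-4)] assms(4)])
       (use assms(5) g_range in \<open>auto simp: mult_left_le\<close>)
qed

lemma cost_bounds: "is_density \<rho> \<Longrightarrow> z \<in> K \<Longrightarrow> 0 \<le> cost g \<rho> z \<and> cost g \<rho> z \<le> 1"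
  using weighted_payoff_bounds[of z "{0..}" \<rho>] by (auto simp: cost_def is_densityD)

lemma bounded_cost: "is_density \<rho> \<Longrightarrow> bounded (cost g \<rho> ` K)"
  using cost_bounds by (intro bounded_imageI[of 0 _ 1]) auto

lemma val_bounds: "is_density \<rho> \<Longrightarrow> 0 \<le> val g V \<rho> \<omega> \<and> val g V \<rho> \<omega> \<le> 1"
  using V_between[of 0 "cost g \<rho>" 1] cost_bounds by (auto simp: val_def)

text \<open>Costs integrate over nonnegative times only, so self-similarity of a density has to be
  checked only there.\<close>

lemma val_cong: "(\<And>t. t \<ge> 0 \<Longrightarrow> \<rho> t = \<rho>' t) \<Longrightarrow> val g V \<rho> = val g V \<rho>'"
proof -
  assume "\<And>t. t \<ge> 0 \<Longrightarrow> \<rho> t = \<rho>' t"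
  then have "cost g \<rho> = cost g \<rho>'"
    unfolding cost_def by (intro ext set_lebesgue_integral_cong) auto
  then show ?thesis by (simp add: val_def)
qed

text \<open>Because \<open>g\<close> is bounded by 1, the costs of two densities differ on each
  trajectory by at most their L1 distance; nonexpansiveness passes this to the values.\<close>

lemma val_L1:
  assumes "is_density \<rho>" "is_density \<rho>'"
  shows "\<bar>val g V \<rho> \<omega> - val g V \<rho>' \<omega>\<bar> \<le> (LINT t:{0..}|lebesgue. \<bar>\<rho> t - \<rho>' t\<bar>)"
  unfolding val_def
proof (rule V_nonexpansive)
  fix z assume z: "z \<in> K"
  have i: "set_integrable lebesgue {0..} (\<lambda>t. \<rho> t - \<rho>' t)"
    using assms by (auto simp: is_densityD)
  have "cost g \<rho> z - cost g \<rho>' z = (LINT t:{0..}|lebesgue. \<rho> t * g (z t) - \<rho>' t * g (z t))"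
    unfolding cost_def using weighted_payoff_integrable[OF z _ _ is_densityD(2)] assms
    by (subst set_integral_diff) auto
  also have "\<dots> = (LINT t:{0..}|lebesgue. (\<rho> t - \<rho>' t) * g (z t))"
    by (simp add: algebra_simps)
  finally show "\<bar>cost g \<rho> z - cost g \<rho>' z\<bar> \<le> (LINT t:{0..}|lebesgue. \<bar>\<rho> t - \<rho>' t\<bar>)"
    using weighted_payoff_abs_le[OF z _ _ i] by simp
qed (use assms bounded_cost in auto)

text \<open>Rescaling preserves the L1 distance, so the bound is uniform in \<open>l\<close>; an
  approximation of the density therefore survives the limit of small \<open>l\<close>.\<close>

lemma val_scale_L1:
  assumes "is_density \<rho>" "is_density \<rho>'" "l > 0"
  shows "\<bar>val g V (scale \<rho> l) \<omega> - val g V (scale \<rho>' l) \<omega>\<bar> \<le> (LINT t:{0..}|lebesgue. \<bar>\<rho> t - \<rho>' t\<bar>)"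
proof -
  have "(LINT t:{0..}|lebesgue. \<bar>scale \<rho> l t - scale \<rho>' l t\<bar>)
      = (LINT t:{0..}|lebesgue. l * \<bar>\<rho> (l * t) - \<rho>' (l * t)\<bar>)"
    using assms(3) by (simp add: scale_def abs_mult flip: right_diff_distrib)
  also have "\<dots> = (LINT t:{0..}|lebesgue. \<bar>\<rho> t - \<rho>' t\<bar>)"
    by (rule set_integral_scale) (use assms(3) in \<open>auto simp: zero_le_mult_iff\<close>)
  finally show ?thesis
    using val_L1[OF is_density_scale[OF assms(1,3)] is_density_scale[OF assms(2,3)]] by simp
qed

text \<open>This payoff depends on the density only through \<open>h\<close>. It is therefore the
  common quantity through which convergence is carried from one family of densities to
  another.\<close>

definition mixed_payoff :: "('w \<Rightarrow> real) \<Rightarrow> real \<Rightarrow> real \<Rightarrow> (real \<Rightarrow> 'w) \<Rightarrow> real" where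
  "mixed_payoff U h T z = h / T * (LINT t:{0..T}|lebesgue. g (z t)) + (1 - h) * U (z T)"

lemma payoff_integral_bounds:
  assumes "z \<in> K" "T > 0"
  shows "0 \<le> (LINT t:{0..T}|lebesgue. g (z t)) / T" "(LINT t:{0..T}|lebesgue. g (z t)) / T \<le> 1"
proof -
  have "set_integrable lebesgue {0..T} (\<lambda>t. 1::real)"
    by (intro absolutely_integrable_on_const) auto
  then have "0 \<le> (LINT t:{0..T}|lebesgue. g (z t))" "(LINT t:{0..T}|lebesgue. g (z t)) \<le> T"
    using weighted_payoff_bounds[OF assms(1), of "{0..T}" "\<lambda>_. 1"] assms(2)
    by (auto simp: set_lebesgue_integral_def)
  then show "0 \<le> (LINT t:{0..T}|lebesgue. g (z t)) / T" "(LINT t:{0..T}|lebesgue. g (z t)) / T \<le> 1"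
    using assms(2) by auto
qed

lemma bounded_mixed_payoff:
  assumes "\<And>\<omega>. 0 \<le> U \<omega> \<and> U \<omega> \<le> 1" "T > 0" "0 \<le> h" "h \<le> 1"
  shows "bounded (mixed_payoff U h T ` K)"
proof (rule bounded_imageI[of 0 _ 1])
  fix z assume "z \<in> K"
  define m where "m = (LINT t:{0..T}|lebesgue. g (z t)) / T"
  have m: "0 \<le> m" "m \<le> 1"
    using payoff_integral_bounds[OF \<open>z \<in> K\<close> assms(2)] by (auto simp: m_def)
  have "h * m + (1 - h) * U (z T) \<le> h * 1 + (1 - h) * 1"
    using m assms by (intro add_mono mult_left_mono) auto
  moreover have "0 \<le> h * m + (1 - h) * U (z T)"
    using m assms by auto
  moreover have "mixed_payoff U h T z = h * m + (1 - h) * U (z T)"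
    by (simp add: mixed_payoff_def m_def)
  ultimately show "0 \<le> mixed_payoff U h T z \<and> mixed_payoff U h T z \<le> 1" by simp
qed

text \<open>The factor \<open>s / T\<close> carries time \<open>T\<close> of the game to time
  \<open>s\<close> of \<open>\<mu>\<close>. The same substitution turns the deviation from the
  constant \<open>h / T\<close> on \<open>{0..T}\<close> into the deviation from
  \<open>h / s\<close> on \<open>{0..s}\<close>.\<close>

lemma head_payoff_approx:
  assumes "is_density \<mu>" "s > 0" "T > 0" "z \<in> K"
  shows "\<bar>(LINT t:{0..T}|lebesgue. scale \<mu> (s / T) t * g (z t)) - h / T * (LINT t:{0..T}|lebesgue. g (z t))\<bar>
    \<le> (LINT t:{0..s}|lebesgue. \<bar>\<mu> t - h / s\<bar>)"
proof -
  define l where "l = s / T"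
  have l: "l > 0" "l * T = s" using assms by (auto simp: l_def)
  have i1: "set_integrable lebesgue {0..T} (scale \<mu> l)"
    using density_integrable_on[OF is_density_scale[OF assms(1) l(1)]] by auto
  have i2: "set_integrable lebesgue {0..T} (\<lambda>t. h / T)"
    by (intro absolutely_integrable_on_const) auto
  have i: "set_integrable lebesgue {0..T} (\<lambda>t. scale \<mu> l t - h / T)"
    using i1 i2 by auto
  have "(LINT t:{0..T}|lebesgue. scale \<mu> l t * g (z t)) - h / T * (LINT t:{0..T}|lebesgue. g (z t))
      = (LINT t:{0..T}|lebesgue. scale \<mu> l t * g (z t)) - (LINT t:{0..T}|lebesgue. h / T * g (z t))"
    by simp
  also have "\<dots> = (LINT t:{0..T}|lebesgue. scale \<mu> l t * g (z t) - h / T * g (z t))"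
    by (rule set_integral_diff(2)[symmetric];
        rule weighted_payoff_integrable[OF assms(4)]) (use i1 i2 in auto)
  also have "\<dots> = (LINT t:{0..T}|lebesgue. (scale \<mu> l t - h / T) * g (z t))"
    by (simp only: left_diff_distrib)
  finally have "\<bar>(LINT t:{0..T}|lebesgue. scale \<mu> l t * g (z t)) - h / T * (LINT t:{0..T}|lebesgue. g (z t))\<bar>
     \<le> (LINT t:{0..T}|lebesgue. \<bar>scale \<mu> l t - h / T\<bar>)"
    using weighted_payoff_abs_le[OF assms(4) _ _ i] by simp
  also have "\<dots> = (LINT t:{0..T}|lebesgue. l * \<bar>\<mu> (l * t) - h / s\<bar>)"
  proof (rule set_lebesgue_integral_cong)
    have "scale \<mu> l t - h / T = l * (\<mu> (l * t) - h / s)" for t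
      using assms by (simp add: scale_def l_def right_diff_distrib)
    then show "\<forall>t. t \<in> {0..T} \<longrightarrow> \<bar>scale \<mu> l t - h / T\<bar> = l * \<bar>\<mu> (l * t) - h / s\<bar>"
      using l(1) by (simp add: abs_mult)
  qed auto
  also have "\<dots> = (LINT t:{0..s}|lebesgue. \<bar>\<mu> t - h / s\<bar>)"
  proof (rule set_integral_scale[OF l(1)])
    show "t \<in> {0..T} \<longleftrightarrow> l * t \<in> {0..s}" for t
      using l by (auto simp: zero_le_mult_iff simp flip: l(2))
  qed
  finally show ?thesis by (simp add: l_def)
qed

text \<open>Dynamic programming at time \<open>T\<close> splits the cost into a head of mass
  \<open>h\<close> and a continuation of weight \<open>1 - h\<close>. Replacing the head by a
  uniform average costs \<open>e2\<close>. Replacing the continuation by \<open>U\<close> costs only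
  \<open>(1 - h) * e1\<close>, and this damping is what the later inductions exploit.\<close>

lemma val_step:
  assumes \<mu>: "is_density \<mu>" and "s > 0" "T > 0" and tail: "tail \<mu> s = 1 - h" "h < 1"
    and U: "\<And>\<omega>. 0 \<le> U \<omega> \<and> U \<omega> \<le> 1"
    and e1: "\<And>\<omega>. \<bar>val g V (scale (shift \<mu> s) (s / T)) \<omega> - U \<omega>\<bar> \<le> e1"
    and e2: "(LINT t:{0..s}|lebesgue. \<bar>\<mu> t - h / s\<bar>) \<le> e2"
  shows "\<bar>val g V (scale \<mu> (s / T)) \<omega> - V (mixed_payoff U h T) \<omega>\<bar> \<le> (1 - h) * e1 + e2"
proof -
  define l where "l = s / T"
  have l: "l > 0" "l * T = s" using assms by (auto simp: l_def)
  have h: "0 \<le> h" using tail_le_1[OF \<mu>, of s] assms by simp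
  have d: "is_density (scale \<mu> l)" using \<mu> l by (rule_tac is_density_scale)
  have tl: "tail (scale \<mu> l) T = 1 - h" using l tail by (simp add: tail_scale)
  have ds: "is_density (scale (shift \<mu> s) l)"
    using assms l by (intro is_density_scale is_density_shift) auto
  have eq: "dcost g V (scale \<mu> l) T z = (LINT t:{0..T}|lebesgue. scale \<mu> l t * g (z t))
      + (1 - h) * val g V (scale (shift \<mu> s) l) (z T)" for z
    by (simp add: dcost_def tl val_def shift_scale[OF l(1)] l(2))
  \<comment> \<open>The crude bound 2 allows 1 for the head and 1 for the weighted
    continuation.\<close>
  have "bounded (dcost g V (scale \<mu> l) T ` K)"
  proof (rule bounded_imageI[of 0 _ 2])
    fix z assume z: "z \<in> K"
    have "0 \<le> (LINT t:{0..T}|lebesgue. scale \<mu> l t * g (z t))"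
      "(LINT t:{0..T}|lebesgue. scale \<mu> l t * g (z t)) \<le> h"
      using weighted_payoff_bounds[OF z, of "{0..T}" "scale \<mu> l"] head_eq[OF d, of T] tl
        density_integrable_on[OF d, of "{0..T}"] is_densityD(1)[OF d] \<open>T > 0\<close> by auto
    moreover have "0 \<le> (1 - h) * val g V (scale (shift \<mu> s) l) (z T)"
      "(1 - h) * val g V (scale (shift \<mu> s) l) (z T) \<le> 1"
      using val_bounds[OF ds, of "z T"] h tail by (auto intro: mult_le_one)
    ultimately show "0 \<le> dcost g V (scale \<mu> l) T z \<and> dcost g V (scale \<mu> l) T z \<le> 2"
      unfolding eq using tail by linarith
  qed
  moreover have "bounded (mixed_payoff U h T ` K)"
    using U assms h by (intro bounded_mixed_payoff) auto
  moreover have "\<bar>dcost g V (scale \<mu> l) T z - mixed_payoff U h T z\<bar> \<le> (1 - h) * e1 + e2"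
    if z: "z \<in> K" for z
  proof -
    have "\<bar>(1 - h) * val g V (scale (shift \<mu> s) l) (z T) - (1 - h) * U (z T)\<bar> \<le> (1 - h) * e1"
      using e1[of "z T"] tail
      by (simp add: abs_mult mult_left_mono flip: l_def right_diff_distrib)
    moreover note head_payoff_approx[OF \<mu> \<open>s > 0\<close> \<open>T > 0\<close> z, of h, folded l_def] e2
    ultimately show ?thesis unfolding eq mixed_payoff_def by linarith
  qed
  ultimately have "\<bar>V (dcost g V (scale \<mu> l) T) \<omega> - V (mixed_payoff U h T) \<omega>\<bar> \<le> (1 - h) * e1 + e2"
    by (rule V_nonexpansive)
  moreover have "V (dcost g V (scale \<mu> l) T) = val g V (scale \<mu> l)"
    using dpp d tl tail \<open>T > 0\<close> unfolding DPP_def val_def by simp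
  ultimately show ?thesis by (simp add: l_def)
qed

text \<open>Dynamic programming presupposes a positive tail. When all mass is used by time
  \<open>s\<close>, the cost is already the payoff over \<open>{0..T}\<close>, and \<open>U\<close>
  enters the mixed payoff with weight 0.\<close>

lemma val_step_last:
  assumes \<mu>: "is_density \<mu>" and "s > 0" "T > 0" and tail: "tail \<mu> s = 0"
    and U: "\<And>\<omega>. 0 \<le> U \<omega> \<and> U \<omega> \<le> 1"
  shows "\<bar>val g V (scale \<mu> (s / T)) \<omega> - V (mixed_payoff U 1 T) \<omega>\<bar>
    \<le> (LINT t:{0..s}|lebesgue. \<bar>\<mu> t - 1 / s\<bar>)"
  unfolding val_def
proof (rule V_nonexpansive)
  define l where "l = s / T"
  have l: "l > 0" "l * T = s" using assms by (auto simp: l_def)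
  have d: "is_density (scale \<mu> (s / T))" using assms by (intro is_density_scale) auto
  then show "bounded (cost g (scale \<mu> (s / T)) ` K)" by (rule bounded_cost)
  show "bounded (mixed_payoff U 1 T ` K)"
    using U assms by (intro bounded_mixed_payoff) auto
  fix z assume z: "z \<in> K"
  have "tail (scale \<mu> (s / T)) T = 0"
    using tail_scale[OF l(1), of \<mu> T] l tail by (simp add: l_def)
  then have "(LINT t:{T..}|lebesgue. scale \<mu> (s / T) t * g (z t)) = 0"
    using weighted_payoff_bounds[OF z, of "{T..}" "scale \<mu> (s / T)"]
      density_integrable_on[OF d, of "{T..}"] is_densityD(1)[OF d] \<open>T > 0\<close>
    by (auto simp: tail_def)
  then have "cost g (scale \<mu> (s / T)) z = (LINT t:{0..T}|lebesgue. scale \<mu> (s / T) t * g (z t))"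
    unfolding cost_def
    using set_integral_split_at[OF weighted_payoff_integrable[OF z _ _ is_densityD(2)[OF d]], of T] \<open>T > 0\<close>
    by simp
  then show "\<bar>cost g (scale \<mu> (s / T)) z - mixed_payoff U 1 T z\<bar> \<le> (LINT t:{0..s}|lebesgue. \<bar>\<mu> t - 1 / s\<bar>)"
    using head_payoff_approx[OF \<mu> \<open>s > 0\<close> \<open>T > 0\<close> z, of 1] by (simp add: mixed_payoff_def)
qed

end

section \<open>Uniform averages and step densities\<close>

text \<open>The limit superior of the uniform distance to \<open>U\<close> is at most
  \<open>a\<close>; for \<open>a = 0\<close> this is uniform convergence. Quantifying over the
  states avoids suprema, and a positive \<open>a\<close> records the error remaining at a finite
  stage of an induction.\<close>

definition unif_within :: "'s filter \<Rightarrow> ('s \<Rightarrow> 'w \<Rightarrow> real) \<Rightarrow> ('w \<Rightarrow> real) \<Rightarrow> real \<Rightarrow> bool" where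
  "unif_within F f U a \<longleftrightarrow> (\<forall>e>0. \<forall>\<^sub>F s in F. \<forall>\<omega>. \<bar>f s \<omega> - U \<omega>\<bar> \<le> a + e)"

lemma unif_withinD:
  "unif_within F f U a \<Longrightarrow> e > 0 \<Longrightarrow> \<forall>\<^sub>F s in F. \<forall>\<omega>. \<bar>f s \<omega> - U \<omega>\<bar> \<le> a + e"
  by (auto simp: unif_within_def)

lemma unif_within_mono: "unif_within F f U a \<Longrightarrow> a \<le> b \<Longrightarrow> unif_within F f U b"
  unfolding unif_within_def
proof (intro allI impI)
  fix e :: real
  assume *: "\<forall>e>0. \<forall>\<^sub>F s in F. \<forall>\<omega>. \<bar>f s \<omega> - U \<omega>\<bar> \<le> a + e" and "a \<le> b" "e > 0"
  then have "\<forall>\<^sub>F s in F. \<forall>\<omega>. \<bar>f s \<omega> - U \<omega>\<bar> \<le> a + e" by blast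
  then show "\<forall>\<^sub>F s in F. \<forall>\<omega>. \<bar>f s \<omega> - U \<omega>\<bar> \<le> b + e"
    by eventually_elim (meson \<open>a \<le> b\<close> add_right_mono order_trans)
qed

lemma unif_withinI_le: "\<forall>\<^sub>F s in F. \<forall>\<omega>. \<bar>f s \<omega> - U \<omega>\<bar> \<le> a \<Longrightarrow> unif_within F f U a"
  unfolding unif_within_def
proof (intro allI impI)
  fix e :: real
  assume "\<forall>\<^sub>F s in F. \<forall>\<omega>. \<bar>f s \<omega> - U \<omega>\<bar> \<le> a" "e > 0"
  then show "\<forall>\<^sub>F s in F. \<forall>\<omega>. \<bar>f s \<omega> - U \<omega>\<bar> \<le> a + e"
    by (elim eventually_mono) (meson add_increasing2 less_imp_le)
qed

lemma unif_within_compose: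
  "unif_within F f U a \<Longrightarrow> filterlim p F G \<Longrightarrow> unif_within G (\<lambda>s. f (p s)) U a"
  unfolding unif_within_def filterlim_iff by blast

lemma unif_within_cong:
  assumes "unif_within F f U a" "\<forall>\<^sub>F s in F. f s = f' s"
  shows "unif_within F f' U a"
  unfolding unif_within_def
proof (intro allI impI)
  fix e :: real assume "e > 0"
  from unif_withinD[OF assms(1) this] assms(2)
  show "\<forall>\<^sub>F s in F. \<forall>\<omega>. \<bar>f' s \<omega> - U \<omega>\<bar> \<le> a + e"
    by eventually_elim simp
qed

lemma unif_within_0I:
  assumes "\<And>e. e > 0 \<Longrightarrow> \<exists>a\<le>e. unif_within F f U a"
  shows "unif_within F f U 0"
  unfolding unif_within_def
proof safe
  fix e :: real assume "e > 0"
  then obtain a where a: "a \<le> e / 2" "unif_within F f U a"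
    using assms[of "e / 2"] by auto
  show "\<forall>\<^sub>F s in F. \<forall>\<omega>. \<bar>f s \<omega> - U \<omega>\<bar> \<le> 0 + e"
    using unif_withinD[OF unif_within_mono[OF a(2,1)], of "e / 2"] \<open>e > 0\<close> by simp
qed

text \<open>Supplies the range \<open>[0,1]\<close> of a limit function about which nothing is
  assumed beforehand.\<close>

lemma unif_within_0_limit_bounds:
  assumes "unif_within F f U 0" "F \<noteq> bot" "\<forall>\<^sub>F s in F. \<forall>\<omega>. 0 \<le> f s \<omega> \<and> f s \<omega> \<le> (1::real)"
  shows "0 \<le> U \<omega> \<and> U \<omega> \<le> 1"
proof -
  have "- e \<le> U \<omega> \<and> U \<omega> \<le> 1 + e" if "e > 0" for e
  proof -
    have "\<forall>\<^sub>F s in F. - e \<le> U \<omega> \<and> U \<omega> \<le> 1 + e"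
      using unif_withinD[OF assms(1) that] assms(3)
      by eventually_elim (smt (verit))
    then show ?thesis using assms(2) by (simp add: eventually_const)
  qed
  then have "0 \<le> U \<omega> + e" "U \<omega> \<le> 1 + e" if "e > 0" for e using that by fastforce+
  then show ?thesis using field_le_epsilon by blast
qed

text \<open>Boundedness of \<open>U\<close> and of the approximating functions makes the real
  \<open>SUP\<close> a true supremum, so it can be compared with the pointwise bounds.\<close>

lemma unif_lim_iff_unif_within:
  fixes U :: "'w \<Rightarrow> real"
  assumes "bounded (range U)" "\<forall>\<^sub>F s in F. bounded (range (f s))"
  shows "unif_lim F f U \<longleftrightarrow> unif_within F f U 0"
proof -
  have bdd: "bdd_above (range (\<lambda>\<omega>. \<bar>f s \<omega> - U \<omega>\<bar>))" if bs: "bounded (range (f s))" for s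
  proof -
    obtain a where a: "\<forall>x\<in>range (f s). norm x \<le> a"
      using bs unfolding bounded_iff by blast
    obtain b where b: "\<forall>x\<in>range U. norm x \<le> b"
      using assms(1) unfolding bounded_iff by blast
    have "\<bar>f s \<omega> - U \<omega>\<bar> \<le> a + b" for \<omega>
      using a[rule_format, of "f s \<omega>"] b[rule_format, of "U \<omega>"] by simp
    then show ?thesis by (intro bdd_aboveI2)
  qed
  show ?thesis
  proof
    assume lim: "unif_lim F f U"
    show "unif_within F f U 0"
      unfolding unif_within_def
    proof safe
      fix e :: real assume "e > 0"
      then have "\<forall>\<^sub>F s in F. (SUP \<omega>. \<bar>f s \<omega> - U \<omega>\<bar>) < e"
        using lim unfolding unif_lim_def by (rule_tac order_tendstoD(2)[of _ 0]) auto
      then show "\<forall>\<^sub>F s in F. \<forall>\<omega>. \<bar>f s \<omega> - U \<omega>\<bar> \<le> 0 + e"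
        using assms(2)
      proof eventually_elim
        case (elim s)
        show ?case
        proof
          fix \<omega>
          have "\<bar>f s \<omega> - U \<omega>\<bar> \<le> (SUP \<omega>. \<bar>f s \<omega> - U \<omega>\<bar>)"
            using bdd[OF elim(2)] by (intro cSUP_upper) auto
          then show "\<bar>f s \<omega> - U \<omega>\<bar> \<le> 0 + e" using elim(1) by simp
        qed
      qed
    qed
  next
    assume w: "unif_within F f U 0"
    show "unif_lim F f U"
      unfolding unif_lim_def
    proof (rule tendstoI)
      fix e :: real assume "e > 0"
      then have "\<forall>\<^sub>F s in F. \<forall>\<omega>. \<bar>f s \<omega> - U \<omega>\<bar> \<le> 0 + e / 2"
        using w by (intro unif_withinD) auto
      then show "\<forall>\<^sub>F s in F. dist (SUP \<omega>. \<bar>f s \<omega> - U \<omega>\<bar>) 0 < e"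
        using assms(2)
      proof eventually_elim
        case (elim s)
        have "(SUP \<omega>. \<bar>f s \<omega> - U \<omega>\<bar>) \<le> e / 2"
          using elim(1) by (intro cSUP_least) auto
        \<comment> \<open>\<open>undefined\<close> merely names some state; its nonnegative term
          bounds the supremum from below.\<close>
        moreover have "0 \<le> (SUP \<omega>. \<bar>f s \<omega> - U \<omega>\<bar>)"
          using bdd[OF elim(2)] by (intro cSUP_upper2[of _ _ undefined]) auto
        ultimately show ?case using \<open>e > 0\<close> by (simp add: dist_real_def)
      qed
    qed
  qed
qed

section \<open>Exchanging large horizons and small scales\<close>

lemma filterlim_divide_at_right_0: "c > 0 \<Longrightarrow> filterlim (\<lambda>T. c / T) (at_right 0) (at_top :: real filter)"
  unfolding filterlim_at
  by (intro conjI tendsto_divide_0[OF tendsto_const] filterlim_at_top_imp_at_infinity filterlim_ident)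
     (auto intro: eventually_mono[OF eventually_gt_at_top[of 0]])

lemma filterlim_divide_at_top: "c > 0 \<Longrightarrow> filterlim (\<lambda>l. c / l) at_top (at_right (0::real))"
  using filterlim_tendsto_pos_mult_at_top[OF tendsto_const _ filterlim_inverse_at_top_right, of c]
  by (simp add: divide_inverse)

lemma filterlim_cmult_at_top: "c > 0 \<Longrightarrow> filterlim (\<lambda>T. c * T) at_top (at_top :: real filter)"
  by (rule filterlim_tendsto_pos_mult_at_top[OF tendsto_const _ filterlim_ident])

section \<open>The uniform density on the unit interval\<close>

abbreviation unit_density :: "real \<Rightarrow> real" where "unit_density \<equiv> indicator {0..1}"

lemma unit_density_scale: "T > 0 \<Longrightarrow> scale unit_density (1 / T) = unif_avg T"
  by (auto simp: scale_def unif_avg_def indicator_def fun_eq_iff field_simps)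

lemma unit_density_tail: "0 \<le> s \<Longrightarrow> s \<le> 1 \<Longrightarrow> tail unit_density s = 1 - s"
proof -
  assume s: "0 \<le> s" "s \<le> 1"
  have "(\<lambda>x. indicator {s..} x *\<^sub>R unit_density x) = (indicator {s..1} :: real \<Rightarrow> real)"
    using s by (auto simp: fun_eq_iff indicator_def)
  then show ?thesis using s by (simp add: tail_def set_lebesgue_integral_def)
qed

lemma is_density_unit: "is_density unit_density"
proof -
  have "(\<lambda>x. indicator {0..} x *\<^sub>R unit_density x) = (\<lambda>x. indicator {0..1::real} x *\<^sub>R 1)"
    by (auto simp: fun_eq_iff indicator_def)
  moreover have "set_integrable lebesgue {0..1::real} (\<lambda>x. 1::real)"
    by (intro absolutely_integrable_on_const) auto
  ultimately show ?thesis
    using unit_density_tail[of 0] by (simp add: is_density_def set_integrable_def tail_def)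
qed

lemma is_density_unif_avg: "T > 0 \<Longrightarrow> is_density (unif_avg T)"
  using is_density_scale[OF is_density_unit, of "1 / T"] by (simp add: unit_density_scale)

section \<open>Convergence of mixed payoffs, uniform averages and step densities\<close>

context dpp_game
begin

context
  fixes U :: "'w \<Rightarrow> real"
  assumes U: "\<And>\<omega>. 0 \<le> U \<omega> \<and> U \<omega> \<le> 1"
begin

lemma val_diff_le_1: "is_density \<rho> \<Longrightarrow> \<bar>val g V \<rho> \<omega> - U \<omega>\<bar> \<le> 1"
  using val_bounds[of \<rho> \<omega>] U[of \<omega>] by linarith

text \<open>Self-similarity makes the continuation in \<open>val_step\<close> a rescaling of the
  same \<open>\<mu>\<close>. Hence both the whole value and the continuation tend to
  \<open>U\<close>, and only the head error \<open>e2\<close> is left.\<close>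

lemma mixed_payoff_within_of_self_similar:
  assumes \<mu>: "is_density \<mu>" and lim: "unif_within (at_right 0) (\<lambda>l. val g V (scale \<mu> l)) U 0"
    and s: "s > 0" "tail \<mu> s = 1 - h" "h < 1"
    and r: "r > 0" "\<And>t. t \<ge> 0 \<Longrightarrow> shift \<mu> s t = scale \<mu> r t"
    and e2: "(LINT t:{0..s}|lebesgue. \<bar>\<mu> t - h / s\<bar>) \<le> e2"
  shows "unif_within at_top (\<lambda>T. V (mixed_payoff U h T)) U e2"
  unfolding unif_within_def
proof (intro allI impI)
  fix e :: real assume "e > 0"
  have h: "0 \<le> h" using tail_le_1[OF \<mu>, of s] s by simp
  have "\<forall>\<^sub>F T in at_top. \<forall>\<omega>. \<bar>val g V (scale \<mu> (c / T)) \<omega> - U \<omega>\<bar> \<le> 0 + e / 2" if "c > 0" for c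
    using \<open>e > 0\<close> that
    by (intro unif_withinD unif_within_compose[OF lim] filterlim_divide_at_right_0) auto
  \<comment> \<open>The whole density appears with factor \<open>s / T\<close>, the continuation
    with the product \<open>r * s / T\<close>; both tend to 0 from the right.\<close>
  from this[of s] this[of "r * s"]
  have "\<forall>\<^sub>F T in at_top. \<forall>\<omega>. \<bar>val g V (scale \<mu> (s / T)) \<omega> - U \<omega>\<bar> \<le> e / 2"
    "\<forall>\<^sub>F T in at_top. \<forall>\<omega>. \<bar>val g V (scale \<mu> (r * s / T)) \<omega> - U \<omega>\<bar> \<le> e / 2"
    using s r by auto
  with eventually_gt_at_top[of 0]
  show "\<forall>\<^sub>F T in at_top. \<forall>\<omega>. \<bar>V (mixed_payoff U h T) \<omega> - U \<omega>\<bar> \<le> e2 + e"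
  proof eventually_elim
    case (elim T)
    have "val g V (scale (shift \<mu> s) (s / T)) = val g V (scale (scale \<mu> r) (s / T))"
      using elim(1) s r(2) by (intro val_cong) (simp add: scale_def)
    then have "\<bar>val g V (scale (shift \<mu> s) (s / T)) \<omega> - U \<omega>\<bar> \<le> e / 2" for \<omega>
      using elim(3) by (simp add: scale_scale)
    from val_step[OF \<mu> s(1) elim(1) s(2,3) U this e2]
    have "\<bar>val g V (scale \<mu> (s / T)) \<omega> - V (mixed_payoff U h T) \<omega>\<bar> \<le> (1 - h) * (e / 2) + e2" for \<omega> .
    moreover have "(1 - h) * (e / 2) \<le> e / 2"
      using h \<open>e > 0\<close> by (simp add: mult_le_cancel_right1)
    ultimately have "\<bar>val g V (scale \<mu> (s / T)) \<omega> - V (mixed_payoff U h T) \<omega>\<bar> \<le> e / 2 + e2" for \<omega>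
      by (meson add_right_mono order_trans)
    show ?case
    proof
      fix \<omega>
      show "\<bar>V (mixed_payoff U h T) \<omega> - U \<omega>\<bar> \<le> e2 + e"
        using elim(2)[rule_format, of \<omega>] \<open>\<bar>val g V (scale \<mu> (s / T)) \<omega> - V (mixed_payoff U h T) \<omega>\<bar> \<le> e / 2 + e2\<close>
        by linarith
    qed
  qed
qed

text \<open>After the first fraction \<open>h\<close> of the horizon, what remains of a uniform
  average is the uniform average of length \<open>(1 - h) * T\<close>. The head is exactly constant,
  so it contributes no error.\<close>

lemma unif_avg_step:
  assumes h: "0 < h" "h < 1" and "T > 0"
    and e1: "\<And>\<omega>. \<bar>val g V (unif_avg ((1 - h) * T)) \<omega> - U \<omega>\<bar> \<le> e1"
  shows "\<bar>val g V (unif_avg T) \<omega> - V (mixed_payoff U h (h * T)) \<omega>\<bar> \<le> (1 - h) * e1"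
proof -
  have t: "tail unit_density h = 1 - h" using h by (simp add: unit_density_tail)
  have "val g V (scale (shift unit_density h) (1 / T)) = val g V (unif_avg ((1 - h) * T))"
    using h \<open>T > 0\<close>
    by (intro val_cong) (auto simp: scale_def shift_def unif_avg_def indicator_def t field_simps)
  moreover have "(LINT t:{0..h}|lebesgue. \<bar>unit_density t - h / h\<bar>) = (LINT t:{0..h}|lebesgue. 0)"
    using h by (intro set_lebesgue_integral_cong) auto
  \<comment> \<open>\<open>val_step\<close> is used with \<open>s = h\<close> at time
    \<open>h * T\<close>, so that the scale factor is \<open>1 / T\<close>.\<close>
  ultimately have "\<bar>val g V (scale unit_density (h / (h * T))) \<omega> - V (mixed_payoff U h (h * T)) \<omega>\<bar>
      \<le> (1 - h) * e1 + 0"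
    using assms t e1 by (intro val_step is_density_unit U) auto
  then show ?thesis using assms by (simp add: unit_density_scale)
qed

lemma unif_avg_within_of_quadratic:
  assumes C: "C \<ge> 0"
    and quad: "\<And>h. 0 < h \<Longrightarrow> h < 1 \<Longrightarrow> unif_within at_top (\<lambda>T. V (mixed_payoff U h T)) U (C * h\<^sup>2)"
  shows "unif_within at_top (\<lambda>T. val g V (unif_avg T)) U 0"
proof -
  \<comment> \<open>\<open>1/(n+1) \<le> ln (n+1) - ln n\<close> turns the accumulated error \<open>C (1/2 + \<dots> + 1/n) / n\<close> into \<open>C ln n / n\<close>.\<close>
  have *: "unif_within at_top (\<lambda>T. val g V (unif_avg T)) U ((1 + C * ln (real (Suc j))) / real (Suc j))" for j
  proof (induction j)
    \<comment> \<open>For a single piece the claimed bound is 1, the largest possible distance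
      between two functions with values in \<open>[0,1]\<close>.\<close>
    case 0
    have "\<forall>\<^sub>F T in at_top. \<forall>\<omega>. \<bar>val g V (unif_avg T) \<omega> - U \<omega>\<bar> \<le> 1"
      using eventually_gt_at_top[of 0]
      by eventually_elim (use val_diff_le_1 is_density_unif_avg in auto)
    then show ?case
      by (intro unif_withinI_le) simp
  next
    case (Suc j)
    define n where "n = real (Suc j)"
    \<comment> \<open>One of \<open>n + 1\<close> equal pieces is peeled off; the induction
      hypothesis covers the remaining average of \<open>n\<close> pieces.\<close>
    define h where "h = 1 / (n + 1)"
    define a where "a = (1 + C * ln n) / n"
    have n: "n > 0" by (simp add: n_def)
    have h: "0 < h" "h < 1" using n by (auto simp: h_def)
    have "(1 - h) * a + C * h\<^sup>2 \<le> (1 + C * ln (n + 1)) / (n + 1)"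
    proof -
      have "(1 - h) * a = (1 + C * ln n) / (n + 1)"
      proof -
        have "1 - h = n / (n + 1)" using n by (simp add: h_def field_simps)
        then show ?thesis using n by (simp add: a_def)
      qed
      moreover have "ln (n / (n + 1)) \<le> n / (n + 1) - 1"
        using n by (intro ln_le_minus_one) auto
      then have "h \<le> ln (n + 1) - ln n"
        using n by (simp add: ln_div h_def field_simps)
      then have "C * h * h \<le> C * (ln (n + 1) - ln n) * h"
        using C h by (intro mult_right_mono mult_left_mono) auto
      then have "C * h\<^sup>2 \<le> C * (ln (n + 1) - ln n) / (n + 1)"
        by (simp add: power2_eq_square h_def mult.assoc)
      ultimately show ?thesis by (simp add: add_divide_distrib diff_divide_distrib right_diff_distrib)
    qed
    \<comment> \<open>As \<open>h\<close> is fixed, the lengths \<open>h * T\<close> and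
      \<open>(1 - h) * T\<close> both tend to infinity with \<open>T\<close>, so both estimates are
      eventually available.\<close>
    moreover have "unif_within at_top (\<lambda>T. val g V (unif_avg T)) U ((1 - h) * a + C * h\<^sup>2)"
      unfolding unif_within_def
    proof (intro allI impI)
      fix e :: real assume "e > 0"
      have "\<forall>\<^sub>F T in at_top. \<forall>\<omega>. \<bar>val g V (unif_avg ((1 - h) * T)) \<omega> - U \<omega>\<bar> \<le> a + e / 2"
        using \<open>e > 0\<close> h
        by (intro unif_withinD unif_within_compose[OF Suc.IH[folded n_def, folded a_def]] filterlim_cmult_at_top) auto
      moreover have "\<forall>\<^sub>F T in at_top. \<forall>\<omega>. \<bar>V (mixed_payoff U h (h * T)) \<omega> - U \<omega>\<bar> \<le> C * h\<^sup>2 + e / 2"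
        using \<open>e > 0\<close> h
        by (intro unif_withinD unif_within_compose[OF quad[OF h]] filterlim_cmult_at_top) auto
      ultimately show "\<forall>\<^sub>F T in at_top. \<forall>\<omega>. \<bar>val g V (unif_avg T) \<omega> - U \<omega>\<bar> \<le> (1 - h) * a + C * h\<^sup>2 + e"
        using eventually_gt_at_top[of 0]
      proof eventually_elim
        case (elim T)
        show ?case
        proof
          fix \<omega>
          have "\<bar>val g V (unif_avg T) \<omega> - V (mixed_payoff U h (h * T)) \<omega>\<bar> \<le> (1 - h) * (a + e / 2)"
            using elim h by (intro unif_avg_step) auto
          moreover have "(1 - h) * (e / 2) \<le> e / 2"
            using h \<open>e > 0\<close> by (simp add: mult_le_cancel_right1)
          moreover have "(1 - h) * (a + e / 2) = (1 - h) * a + (1 - h) * (e / 2)"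
            by (rule distrib_left)
          ultimately show "\<bar>val g V (unif_avg T) \<omega> - U \<omega>\<bar> \<le> (1 - h) * a + C * h\<^sup>2 + e"
            using elim(2)[rule_format, of \<omega>] by linarith
        qed
      qed
    qed
    ultimately show ?case
      by (auto intro: unif_within_mono simp: n_def add_ac)
  qed
  show ?thesis
  \<comment> \<open>The number of pieces is chosen from \<open>e\<close> alone, before the horizon
    grows.\<close>
  proof (rule unif_within_0I)
    fix e :: real assume "e > 0"
    have "(\<lambda>j. 1 / real (Suc j) + C * (ln (real (Suc j)) / real (Suc j))) \<longlonglongrightarrow> 0 + C * 0"
      by (intro tendsto_intros LIMSEQ_Suc[OF lim_1_over_n] LIMSEQ_Suc[OF lim_ln_over_n])
    then have "(\<lambda>j. (1 + C * ln (real (Suc j))) / real (Suc j)) \<longlonglongrightarrow> 0"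
      by (simp add: add_divide_distrib)
    then have "\<forall>\<^sub>F j in sequentially. (1 + C * ln (real (Suc j))) / real (Suc j) < e"
      using \<open>e > 0\<close> by (rule order_tendstoD)
    then obtain j where "(1 + C * ln (real (Suc j))) / real (Suc j) < e"
      using eventually_happens trivial_limit_sequentially by blast
    with * show "\<exists>a\<le>e. unif_within at_top (\<lambda>T. val g V (unif_avg T)) U a"
      by (meson less_imp_le)
  qed
qed

text \<open>\<open>unif_avg_step\<close> read backwards: if the average and its remainder both tend
  to \<open>U\<close>, so does the mixed payoff linking them. The endpoints of \<open>[0,1]\<close>
  are included because a cell of a step density may carry no mass or all of it.\<close>

lemma mixed_payoff_lim_of_unif_avg:
  assumes lim: "unif_within at_top (\<lambda>T. val g V (unif_avg T)) U 0" and h: "0 \<le> h" "h \<le> 1"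
  shows "unif_within at_top (\<lambda>T. V (mixed_payoff U h T)) U 0"
proof -
  have inner: "unif_within at_top (\<lambda>T. V (mixed_payoff U h T)) U 0" if h: "0 < h" "h < 1" for h
    unfolding unif_within_def
  proof (intro allI impI)
    fix e :: real assume "e > 0"
    have ev: "\<forall>\<^sub>F T in at_top. \<forall>\<omega>. \<bar>val g V (unif_avg (c * T)) \<omega> - U \<omega>\<bar> \<le> e / 2" if "c > 0" for c
      using unif_withinD[OF unif_within_compose[OF lim filterlim_cmult_at_top[OF that]], of "e / 2"] \<open>e > 0\<close>
      by simp
    \<comment> \<open>With horizon \<open>T / h\<close> the head has length exactly \<open>T\<close>
      and the remainder has length \<open>(1 - h) / h * T\<close>.\<close>
    have "1 / h > 0" "(1 - h) / h > 0" using h by auto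
    from ev[OF this(1)] ev[OF this(2)] eventually_gt_at_top[of 0]
    show "\<forall>\<^sub>F T in at_top. \<forall>\<omega>. \<bar>V (mixed_payoff U h T) \<omega> - U \<omega>\<bar> \<le> 0 + e"
    proof eventually_elim
      case (elim T)
      show ?case
      proof
        fix \<omega>
        have "\<bar>val g V (unif_avg (1 / h * T)) \<omega> - V (mixed_payoff U h (h * (1 / h * T))) \<omega>\<bar> \<le> (1 - h) * (e / 2)"
          using elim h by (intro unif_avg_step) auto
        moreover have "(1 - h) * (e / 2) \<le> e / 2"
          using h \<open>e > 0\<close> by (simp add: mult_le_cancel_right1)
        moreover have "mixed_payoff U h (h * (1 / h * T)) = mixed_payoff U h T" using h by simp
        ultimately show "\<bar>V (mixed_payoff U h T) \<omega> - U \<omega>\<bar> \<le> 0 + e"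
          using elim(1)[rule_format, of \<omega>] by (simp only:)
      qed
    qed
  qed
  consider "0 < h" "h < 1" | "h = 0" | "h = 1" using h by linarith
  then show ?thesis
  proof cases
    case 1 then show ?thesis by (rule inner)
  next
    \<comment> \<open>The step above needs \<open>h > 0\<close>. For \<open>h = 0\<close> the payoff
      is compared with the one for a small \<open>k\<close>, which is uniformly within
      \<open>k\<close> of it; the cap \<open>1 / 2\<close> keeps \<open>k < 1\<close>.\<close>
    case 2
    show ?thesis
    proof (rule unif_within_0I)
      fix e :: real assume "e > 0"
      define k where "k = min e (1 / 2)"
      have k: "0 < k" "k < 1" "k \<le> e" using \<open>e > 0\<close> by (auto simp: k_def)
      have "unif_within at_top (\<lambda>T. V (mixed_payoff U h T)) U k"
        unfolding unif_within_def
      proof (intro allI impI)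
        fix d :: real assume "d > 0"
        from unif_withinD[OF inner[OF k(1,2)] this] eventually_gt_at_top[of 0]
        show "\<forall>\<^sub>F T in at_top. \<forall>\<omega>. \<bar>V (mixed_payoff U h T) \<omega> - U \<omega>\<bar> \<le> k + d"
        proof eventually_elim
          case (elim T)
          have "\<bar>mixed_payoff U h T z - mixed_payoff U k T z\<bar> \<le> k" if "z \<in> K" for z
          proof -
            define m where "m = (LINT t:{0..T}|lebesgue. g (z t)) / T"
            have "mixed_payoff U h T z - mixed_payoff U k T z = k * (U (z T) - m)"
              by (simp add: mixed_payoff_def m_def 2 algebra_simps)
            moreover have "\<bar>U (z T) - m\<bar> \<le> 1"
              using payoff_integral_bounds[OF that elim(2)] U[of "z T"] unfolding m_def by linarith
            ultimately show ?thesis using k by (simp add: abs_mult mult_left_le)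
          qed
          then have *: "\<bar>V (mixed_payoff U h T) \<omega> - V (mixed_payoff U k T) \<omega>\<bar> \<le> k" for \<omega>
            using elim U k 2 by (intro V_nonexpansive bounded_mixed_payoff) auto
          show ?case
          proof
            fix \<omega>
            show "\<bar>V (mixed_payoff U h T) \<omega> - U \<omega>\<bar> \<le> k + d"
              using elim(1)[rule_format, of \<omega>] *[of \<omega>] by linarith
          qed
        qed
      qed
      then show "\<exists>a\<le>e. unif_within at_top (\<lambda>T. V (mixed_payoff U h T)) U a"
        using k by blast
    qed
  next
    \<comment> \<open>For \<open>h = 1\<close> the mixed payoff has the same value as the uniform
      average, so the assumed limit applies directly.\<close>
    case 3
    have "(LINT t:{0..1}|lebesgue. \<bar>unit_density t - 1 / 1\<bar>) = (LINT t:{0..1::real}|lebesgue. 0)"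
      by (intro set_lebesgue_integral_cong) auto
    then have eq: "val g V (unif_avg T) \<omega> = V (mixed_payoff U h T) \<omega>" if "T > 0" for T \<omega>
      using val_step_last[OF is_density_unit _ that, of 1 U \<omega>] U that
      by (simp add: unit_density_tail unit_density_scale 3)
    show ?thesis
      unfolding unif_within_def
    proof (intro allI impI)
      fix e :: real assume "e > 0"
      from unif_withinD[OF lim this] eventually_gt_at_top[of 0]
      show "\<forall>\<^sub>F T in at_top. \<forall>\<omega>. \<bar>V (mixed_payoff U h T) \<omega> - U \<omega>\<bar> \<le> 0 + e"
        by eventually_elim (simp add: eq)
    qed
  qed
qed

text \<open>Cells are peeled off one at a time by dynamic programming. A constant head makes no
  error, so the only error is the mass beyond the last of the \<open>N\<close> cells, where nothing
  is known about \<open>\<mu>\<close>.\<close>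

lemma step_density_within:
  assumes lim: "unif_within at_top (\<lambda>T. val g V (unif_avg T)) U 0" and "\<delta> > 0"
  shows "is_density \<mu> \<Longrightarrow> (\<And>k. k < N \<Longrightarrow> \<exists>c. \<forall>t\<in>{real k * \<delta>..<real (Suc k) * \<delta>}. \<mu> t = c)
    \<Longrightarrow> unif_within (at_right 0) (\<lambda>l. val g V (scale \<mu> l)) U (tail \<mu> (real N * \<delta>))"
proof (induction N arbitrary: \<mu>)
  case 0
  have "\<forall>\<^sub>F l in at_right 0. \<forall>\<omega>. \<bar>val g V (scale \<mu> l) \<omega> - U \<omega>\<bar> \<le> 1"
    using eventually_at_right_less[of 0]
    by eventually_elim (use val_diff_le_1 is_density_scale 0 in auto)
  then show ?case
    using 0 by (intro unif_withinI_le) (simp add: tail_0)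
next
  case (Suc N)
  define h where "h = 1 - tail \<mu> \<delta>"
  have h: "0 \<le> h" "h \<le> 1" "tail \<mu> \<delta> = 1 - h"
    using tail_nonneg[OF Suc.prems(1), of \<delta>] tail_le_1[OF Suc.prems(1), of \<delta>] \<open>\<delta> > 0\<close>
    by (auto simp: h_def)
  obtain c where c: "\<And>t. t \<in> {0..<\<delta>} \<Longrightarrow> \<mu> t = c"
    using Suc.prems(2)[of 0] by auto
  \<comment> \<open>The point \<open>\<delta>\<close> belongs to the next cell, where the density
    may take another value.\<close>
  have null: "(LINT t:{0..\<delta>}|lebesgue. f t) = (LINT t:{0..<\<delta>}|lebesgue. f t)" for f :: "real \<Rightarrow> real"
    by (rule set_integral_null_symdiff[where c = \<delta>]) auto
  have "h = (LINT t:{0..\<delta>}|lebesgue. \<mu> t)"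
    using head_eq[OF Suc.prems(1), of \<delta>] \<open>\<delta> > 0\<close> by (simp add: h_def)
  also have "\<dots> = (LINT t:{0..<\<delta>}|lebesgue. c)"
    unfolding null using c by (intro set_lebesgue_integral_cong) auto
  also have "\<dots> = c * \<delta>"
    using \<open>\<delta> > 0\<close> by (simp add: set_lebesgue_integral_def)
  \<comment> \<open>The mean height \<open>h / \<delta>\<close> is the constant value of the cell,
    so the head deviation vanishes.\<close>
  finally have hc: "h / \<delta> = c" using \<open>\<delta> > 0\<close> by simp
  have "(LINT t:{0..\<delta>}|lebesgue. \<bar>\<mu> t - h / \<delta>\<bar>) = (LINT t:{0..<\<delta>}|lebesgue. 0)"
    unfolding null using c by (intro set_lebesgue_integral_cong) (auto simp: hc)
  then have e2: "(LINT t:{0..\<delta>}|lebesgue. \<bar>\<mu> t - h / \<delta>\<bar>) = 0" by simp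
  have mix: "unif_within (at_right 0) (\<lambda>l. V (mixed_payoff U h (\<delta> / l))) U 0"
    using \<open>\<delta> > 0\<close> h
    by (intro unif_within_compose[OF mixed_payoff_lim_of_unif_avg[OF lim]] filterlim_divide_at_top) auto
  show ?case
  proof (cases "h = 1")
    \<comment> \<open>All mass lies in the first cell, so no conditional density remains for the
      induction hypothesis.\<close>
    case True
    show ?thesis
      unfolding unif_within_def
    proof (intro allI impI)
      fix e :: real assume "e > 0"
      from unif_withinD[OF mix this] eventually_at_right_less[of 0]
      show "\<forall>\<^sub>F l in at_right 0. \<forall>\<omega>. \<bar>val g V (scale \<mu> l) \<omega> - U \<omega>\<bar> \<le> tail \<mu> (real (Suc N) * \<delta>) + e"
      proof eventually_elim
        case (elim l)
        have "0 \<le> tail \<mu> (real (Suc N) * \<delta>)"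
          using tail_nonneg[OF Suc.prems(1), of "real (Suc N) * \<delta>"] \<open>\<delta> > 0\<close> by simp
        moreover have "val g V (scale \<mu> l) \<omega> = V (mixed_payoff U h (\<delta> / l)) \<omega>" for \<omega>
          using val_step_last[OF Suc.prems(1) \<open>\<delta> > 0\<close>, of "\<delta> / l" U \<omega>] elim(2) \<open>\<delta> > 0\<close> U e2 h True
          by simp
        ultimately show ?case using elim(1) by (smt (verit))
      qed
    qed
  next
    case False
    then have h1: "h < 1" using h by simp
    \<comment> \<open>The error \<open>a\<close> of the conditional density is its tail; the weight
      \<open>1 - h\<close> turns it back into the tail of \<open>\<mu>\<close>, so peeling does not
      accumulate errors.\<close>
    define a where "a = tail (shift \<mu> \<delta>) (real N * \<delta>)"
    have "\<delta> + real N * \<delta> = real (Suc N) * \<delta>" by (simp add: algebra_simps)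
    then have a: "(1 - h) * a = tail \<mu> (real (Suc N) * \<delta>)"
      using h1 by (simp add: a_def tail_shift h(3))
    have IH: "unif_within (at_right 0) (\<lambda>l. val g V (scale (shift \<mu> \<delta>) l)) U a"
      unfolding a_def
    proof (rule Suc.IH)
      show "is_density (shift \<mu> \<delta>)"
        using Suc.prems(1) \<open>\<delta> > 0\<close> h h1 by (intro is_density_shift) auto
      fix k assume "k < N"
      then obtain c where c: "\<And>t. t \<in> {real (Suc k) * \<delta>..<real (Suc (Suc k)) * \<delta>} \<Longrightarrow> \<mu> t = c"
        using Suc.prems(2)[of "Suc k"] by auto
      have "shift \<mu> \<delta> t = c / tail \<mu> \<delta>" if "t \<in> {real k * \<delta>..<real (Suc k) * \<delta>}" for t
        using that c[of "t + \<delta>"] by (simp add: shift_def algebra_simps)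
      then show "\<exists>c. \<forall>t\<in>{real k * \<delta>..<real (Suc k) * \<delta>}. shift \<mu> \<delta> t = c" by blast
    qed
    show ?thesis
      unfolding unif_within_def
    proof (intro allI impI)
      fix e :: real assume "e > 0"
      then have "e / 2 > 0" by simp
      from unif_withinD[OF mix this] unif_withinD[OF IH this] eventually_at_right_less[of 0]
      show "\<forall>\<^sub>F l in at_right 0. \<forall>\<omega>. \<bar>val g V (scale \<mu> l) \<omega> - U \<omega>\<bar> \<le> tail \<mu> (real (Suc N) * \<delta>) + e"
      proof eventually_elim
        case (elim l)
        show ?case
        proof
          fix \<omega>
          have T: "\<delta> / l > 0" "\<delta> / (\<delta> / l) = l" using elim \<open>\<delta> > 0\<close> by auto
          have "\<bar>val g V (scale \<mu> l) \<omega> - V (mixed_payoff U h (\<delta> / l)) \<omega>\<bar> \<le> (1 - h) * (a + e / 2) + 0"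
            using val_step[OF Suc.prems(1) \<open>\<delta> > 0\<close> T(1) h(3) h1 _ _ eq_refl[OF e2], of U "a + e / 2" \<omega>]
              elim(2) U unfolding T(2) by blast
          moreover have "(1 - h) * (e / 2) \<le> e / 2"
            using h \<open>e > 0\<close> by (simp add: mult_le_cancel_right1)
          moreover have "(1 - h) * (a + e / 2) = (1 - h) * a + (1 - h) * (e / 2)"
            by (rule distrib_left)
          ultimately show "\<bar>val g V (scale \<mu> l) \<omega> - U \<omega>\<bar> \<le> tail \<mu> (real (Suc N) * \<delta>) + e"
            using elim(1)[rule_format, of \<omega>] a by linarith
        qed
      qed
    qed
  qed
qed

end

end

section \<open>Approximation by cell averages\<close>

lemma set_integrable_const_Ico: "set_integrable lebesgue {a..<b::real} (\<lambda>_. c::real)"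
proof -
  have "set_integrable lebesgue {a..b} (\<lambda>_. c)"
    by (intro absolutely_integrable_on_const) auto
  then show ?thesis by (rule set_integrable_subset) auto
qed

lemma set_integral_const_Ico: "a \<le> b \<Longrightarrow> (LINT t:{a..<b::real}|lebesgue. c) = c * (b - a :: real)"
  by (simp add: set_lebesgue_integral_def)

text \<open>A conditional expectation over cells of length \<open>1 / n\<close>. From time
  \<open>n\<close> on, \<open>\<mu>\<close> itself is kept, so that total mass and tail are
  preserved without renormalisation.\<close>

definition cell_avg :: "(real \<Rightarrow> real) \<Rightarrow> nat \<Rightarrow> real \<Rightarrow> real" where
  "cell_avg \<mu> n t = (if t < real n
     then real n * (LINT x:{\<lfloor>real n * t\<rfloor> / real n..<(\<lfloor>real n * t\<rfloor> + 1) / real n}|lebesgue. \<mu> x)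
     else \<mu> t)"

context
  fixes \<mu> :: "real \<Rightarrow> real" and n :: nat
  assumes \<mu>: "is_density \<mu>" and n: "n > 0"
begin

lemma cell_avg_on_cell:
  assumes "k < n * n" "t \<in> {real k / real n..<real (Suc k) / real n}"
  shows "cell_avg \<mu> n t = real n * (LINT x:{real k / real n..<real (Suc k) / real n}|lebesgue. \<mu> x)"
proof -
  have "\<lfloor>real n * t\<rfloor> = int k"
    using assms(2) n by (auto simp: floor_eq_iff field_simps)
  moreover have "real (Suc k) \<le> real n * real n"
    using assms(1) by (metis Suc_leI of_nat_le_iff of_nat_mult)
  then have "t < real n"
  proof -
    have "t * real n < real (Suc k)"
      using assms(2) n by (simp add: pos_less_divide_eq)
    then have "t * real n < real n * real n"
      using \<open>real (Suc k) \<le> real n * real n\<close> by linarith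
    then show ?thesis by (rule mult_right_less_imp_less) simp
  qed
  ultimately show ?thesis by (simp add: cell_avg_def add.commute)
qed

lemma cell_avg_nonneg: "t \<ge> 0 \<Longrightarrow> cell_avg \<mu> n t \<ge> 0"
proof -
  assume "t \<ge> 0"
  have "0 \<le> (LINT x:{\<lfloor>real n * t\<rfloor> / real n..<(\<lfloor>real n * t\<rfloor> + 1) / real n}|lebesgue. \<mu> x)"
    unfolding set_lebesgue_integral_def
  proof (rule integral_nonneg_AE, rule AE_I2)
    fix x
    have "0 \<le> \<lfloor>real n * t\<rfloor> / real n" using \<open>t \<ge> 0\<close> by simp
    then show "0 \<le> indicat_real {\<lfloor>real n * t\<rfloor> / real n..<(\<lfloor>real n * t\<rfloor> + 1) / real n} x *\<^sub>R \<mu> x"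
      using is_densityD(1)[OF \<mu>, of x] by (auto simp: indicator_def)
  qed
  then show ?thesis using \<open>t \<ge> 0\<close> is_densityD(1)[OF \<mu>] by (simp add: cell_avg_def)
qed

text \<open>Averaging preserves the mass of each cell; the prefixes add these masses up. There are
  \<open>n * n\<close> cells because cells of length \<open>1 / n\<close> have to fill
  \<open>[0,n)\<close>.\<close>

lemma cell_avg_integral_prefix:
  "k \<le> n * n \<Longrightarrow> set_integrable lebesgue {0..<real k / real n} (cell_avg \<mu> n) \<and>
    (LINT t:{0..<real k / real n}|lebesgue. cell_avg \<mu> n t) = (LINT t:{0..<real k / real n}|lebesgue. \<mu> t)"
proof (induction k)
  case 0
  then show ?case by (simp add: set_lebesgue_integral_def)
next
  case (Suc k)
  define A where "A = {0..<real k / real n}"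
  define B where "B = {real k / real n..<real (Suc k) / real n}"
  define m where "m = (LINT x:B|lebesgue. \<mu> x)"
  have cell: "cell_avg \<mu> n t = real n * m" if "t \<in> B" for t
    using cell_avg_on_cell[of k t] Suc.prems that by (simp add: B_def m_def)
  have un: "{0..<real (Suc k) / real n} = A \<union> B" "A \<inter> B = {}"
    unfolding A_def B_def by (subst ivl_disj_un_two(3)) (auto simp: divide_right_mono)
  have iA: "set_integrable lebesgue A (cell_avg \<mu> n)"
    and eA: "(LINT t:A|lebesgue. cell_avg \<mu> n t) = (LINT t:A|lebesgue. \<mu> t)"
    using Suc by (auto simp: A_def)
  have iB: "set_integrable lebesgue B (cell_avg \<mu> n)"
    using set_integrable_cong[of lebesgue lebesgue B B "cell_avg \<mu> n" "\<lambda>_. real n * m"] cell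
      set_integrable_const_Ico[of _ _ "real n * m"] by (simp add: B_def)
  have "(LINT t:B|lebesgue. cell_avg \<mu> n t) = (LINT t:B|lebesgue. real n * m)"
    using cell by (intro set_lebesgue_integral_cong) (auto simp: B_def)
  also have "\<dots> = real n * m * (real (Suc k) / real n - real k / real n)"
    unfolding B_def by (intro set_integral_const_Ico) (simp add: divide_right_mono)
  also have "\<dots> = m"
    using n by (simp add: field_simps)
  finally have eB: "(LINT t:B|lebesgue. cell_avg \<mu> n t) = (LINT t:B|lebesgue. \<mu> t)"
    by (simp add: m_def)
  have "set_integrable lebesgue A \<mu>" "set_integrable lebesgue B \<mu>"
    using density_integrable_on[OF \<mu>, of A] density_integrable_on[OF \<mu>, of B] un(1)
    by (fastforce simp: A_def B_def)+
  then show ?case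
    unfolding un(1) using iA iB eA eB un(2)
    by (auto simp: set_integral_Un A_def B_def intro!: set_integrable_Un)
qed

lemma is_density_cell_avg: "is_density (cell_avg \<mu> n)"
  and tail_cell_avg: "tail (cell_avg \<mu> n) (real n) = tail \<mu> (real n)"
proof -
  have pre: "set_integrable lebesgue {0..<real n} (cell_avg \<mu> n)"
    "(LINT t:{0..<real n}|lebesgue. cell_avg \<mu> n t) = (LINT t:{0..<real n}|lebesgue. \<mu> t)"
    using cell_avg_integral_prefix[of "n * n"] n by auto
  have i: "set_integrable lebesgue {real n..} \<mu>" "set_integrable lebesgue {0..<real n} \<mu>"
    by (rule density_integrable_on[OF \<mu>]; auto)+
  have post: "set_integrable lebesgue {real n..} (cell_avg \<mu> n)"
    using set_integrable_cong[of lebesgue lebesgue "{real n..}" "{real n..}" "cell_avg \<mu> n" \<mu>] i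
    by (simp add: cell_avg_def)
  show t: "tail (cell_avg \<mu> n) (real n) = tail \<mu> (real n)"
    unfolding tail_def by (intro set_lebesgue_integral_cong) (auto simp: cell_avg_def)
  have un: "{0..} = {0..<real n} \<union> {real n..}" "{0..<real n} \<inter> {real n..} = {}" by auto
  have "(LINT t:{0..}|lebesgue. cell_avg \<mu> n t) = (LINT t:{0..}|lebesgue. \<mu> t)"
    unfolding un(1) using set_integral_Un[OF un(2) pre(1) post] set_integral_Un[OF un(2) i(2,1)] pre t
    by (simp add: tail_def)
  moreover have "set_integrable lebesgue {0..} (cell_avg \<mu> n)"
    unfolding un(1) using pre post by (intro set_integrable_Un) auto
  ultimately show "is_density (cell_avg \<mu> n)"
    using cell_avg_nonneg is_densityD(3)[OF \<mu>] by (simp add: is_density_def)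
qed

text \<open>All points of the cell of \<open>x\<close> are closer than \<open>1 / n\<close> to
  \<open>x\<close>, so bounds for \<open>\<mu>\<close> near \<open>x\<close> are inherited by its
  mean over the cell.\<close>

lemma cell_avg_close:
  assumes "0 < x" "x < real n" and close: "\<And>y. \<bar>y - x\<bar> < 1 / real n \<Longrightarrow> \<bar>\<mu> y - \<mu> x\<bar> \<le> e"
  shows "\<bar>cell_avg \<mu> n x - \<mu> x\<bar> \<le> e"
proof -
  define a where "a = real_of_int \<lfloor>real n * x\<rfloor> / real n"
  define b where "b = (real_of_int \<lfloor>real n * x\<rfloor> + 1) / real n"
  have ab: "b - a = 1 / real n" "a \<le> x" "x < b" "a \<ge> 0" "a \<le> b"
    using n assms(1) floor_correct[of "real n * x"] by (auto simp: a_def b_def field_simps)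
  have i: "set_integrable lebesgue {a..<b} \<mu>"
    by (rule density_integrable_on[OF \<mu>]) (use ab in auto)
  have *: "\<mu> x - e \<le> \<mu> y \<and> \<mu> y \<le> \<mu> x + e" if "y \<in> {a..<b}" for y
  proof -
    have "a \<le> y" "y < b" using that by auto
    then have "\<bar>y - x\<bar> < 1 / real n" using ab by linarith
    then show ?thesis using close[of y] by linarith
  qed
  have "(LINT t:{a..<b}|lebesgue. \<mu> x - e) \<le> (LINT t:{a..<b}|lebesgue. \<mu> t)"
    using * by (intro set_integral_mono set_integrable_const_Ico i) auto
  moreover have "(LINT t:{a..<b}|lebesgue. \<mu> t) \<le> (LINT t:{a..<b}|lebesgue. \<mu> x + e)"
    using * by (intro set_integral_mono set_integrable_const_Ico i) auto
  moreover have "cell_avg \<mu> n x = real n * (LINT t:{a..<b}|lebesgue. \<mu> t)"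
    using assms by (simp add: cell_avg_def a_def b_def)
  ultimately show ?thesis
    using n ab by (simp add: set_integral_const_Ico field_simps abs_le_iff)
qed

end

text \<open>Exhausting the positive half-line by countably many compact intervals leaves a
  countable, hence null, set of possible discontinuities.\<close>

lemma pw_continuous_pos_AE:
  assumes "pw_continuous_pos f"
  shows "AE x in lebesgue. x > 0 \<longrightarrow> isCont f x"
proof -
  have "\<exists>S. finite S \<and> (\<forall>x\<in>{1 / real (Suc n)..real n + 2} - S. isCont f x)" for n
  proof -
    \<comment> \<open>The summand 2 keeps the interval nondegenerate even for
      \<open>n = 0\<close>.\<close>
    have "1 / real (Suc n) \<le> 1" by simp
    also have "1 < real n + 2" by simp
    finally show ?thesis using assms unfolding pw_continuous_pos_def by simp
  qed
  then obtain S where S: "\<And>n. finite (S n)"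
    "\<And>n x. x \<in> {1 / real (Suc n)..real n + 2} - S n \<Longrightarrow> isCont f x"
    by metis
  have "countable (\<Union>n. S n)" using S(1) by (auto intro: countable_finite)
  then have "AE x in lborel. x \<notin> (\<Union>n. S n)"
    by (intro AE_not_in countable_imp_null_set_lborel)
  then have "AE x in lebesgue. x \<notin> (\<Union>n. S n)" by (rule AE_completion)
  then show ?thesis
  proof eventually_elim
    case (elim x)
    show ?case
    proof
      assume "x > 0"
      obtain m where m: "1 / real (Suc m) < x" using \<open>x > 0\<close> nat_approx_posE by metis
      obtain k where k: "x \<le> real k" using real_arch_simple by blast
      define j where "j = max m k"
      have "1 / real (Suc j) \<le> 1 / real (Suc m)" by (intro divide_left_mono) (auto simp: j_def)
      moreover have "real k \<le> real j" by (simp add: j_def)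
      ultimately have "x \<in> {1 / real (Suc j)..real j + 2}" using m k by auto
      then show "isCont f x" using S(2)[of x j] elim by auto
    qed
  qed
qed

lemma cell_avg_tendsto:
  assumes "is_density \<mu>" "x > 0" "isCont \<mu> x"
  shows "(\<lambda>n. cell_avg \<mu> (Suc n) x) \<longlonglongrightarrow> \<mu> x"
proof (rule LIMSEQ_I)
  fix r :: real assume "r > 0"
  then obtain d where d: "d > 0" "\<And>y. \<bar>y - x\<bar> < d \<Longrightarrow> \<bar>\<mu> y - \<mu> x\<bar> < r / 2"
    using assms(3)[unfolded continuous_at_eps_delta, rule_format, of "r / 2"]
    by (auto simp: dist_real_def)
  \<comment> \<open>\<open>m\<close> makes the cells fit into the continuity radius;
    \<open>k\<close> puts \<open>x\<close> below the point where averaging stops.\<close>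
  obtain m where m: "1 / real (Suc m) < d" using d(1) nat_approx_posE by metis
  obtain k where k: "x < real k" using reals_Archimedean2 by blast
  show "\<exists>no. \<forall>n\<ge>no. norm (cell_avg \<mu> (Suc n) x - \<mu> x) < r"
  proof (intro exI allI impI)
    fix n assume n: "max m k \<le> n"
    have "1 / real (Suc n) \<le> 1 / real (Suc m)" using n by (intro divide_left_mono) auto
    then have "\<bar>\<mu> y - \<mu> x\<bar> \<le> r / 2" if "\<bar>y - x\<bar> < 1 / real (Suc n)" for y
      using d(2)[of y] m that by simp
    moreover have "x < real (Suc n)" using n k by simp
    ultimately have "\<bar>cell_avg \<mu> (Suc n) x - \<mu> x\<bar> \<le> r / 2"
      using assms by (intro cell_avg_close) auto
    then show "norm (cell_avg \<mu> (Suc n) x - \<mu> x) < r" using \<open>r > 0\<close> by simp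
  qed
qed

text \<open>Cell averages converge almost everywhere. All the functions are nonnegative with
  integral 1, so Scheffe's lemma upgrades this to L1 convergence.\<close>

lemma cell_avg_L1:
  assumes \<mu>: "is_density \<mu>" and pw: "pw_continuous_pos \<mu>" and "e > 0"
  shows "\<forall>\<^sub>F n in sequentially. (LINT t:{0..}|lebesgue. \<bar>cell_avg \<mu> (Suc n) t - \<mu> t\<bar>) < e"
proof -
  have norm1: "(\<integral>\<^sup>+ x. norm (indicator {0..} x *\<^sub>R \<rho> x) \<partial>lebesgue) = 1" if "is_density \<rho>" for \<rho>
  proof -
    have "(\<integral>\<^sup>+ x. norm (indicator {0..} x *\<^sub>R \<rho> x) \<partial>lebesgue)
        = (\<integral>\<^sup>+ x. ennreal (indicator {0..} x *\<^sub>R \<rho> x) \<partial>lebesgue)"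
      using that by (intro nn_integral_cong) (auto simp: indicator_def is_densityD)
    also have "\<dots> = ennreal (LINT t:{0..}|lebesgue. \<rho> t)"
      unfolding set_lebesgue_integral_def using that is_densityD(2)[OF that]
      by (intro nn_integral_eq_integral) (auto simp: indicator_def is_densityD set_integrable_def)
    finally show ?thesis using that by (simp add: is_densityD)
  qed
  have d: "is_density (cell_avg \<mu> (Suc n))" for n using is_density_cell_avg[OF \<mu>] by simp
  let ?F = "\<lambda>n x. indicator {0..} x *\<^sub>R cell_avg \<mu> (Suc n) x"
  let ?f = "\<lambda>x. indicator {0..} x *\<^sub>R \<mu> x"
  \<comment> \<open>Piecewise continuity says nothing at 0, which is discarded as a null
    point.\<close>
  have "AE x in lborel. x \<notin> {0::real}" by (rule AE_not_in) (auto intro: countable_imp_null_set_lborel)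
  then have "AE x in lebesgue. x \<noteq> (0::real)" by (auto dest: AE_completion)
  with pw_continuous_pos_AE[OF pw] have ae: "AE x in lebesgue. (\<lambda>n. ?F n x) \<longlonglongrightarrow> ?f x"
  proof eventually_elim
    case (elim x)
    then show ?case using cell_avg_tendsto[OF \<mu>, of x] by (cases "x > 0") auto
  qed
  have int: "integrable lebesgue (?F n)" "integrable lebesgue ?f" for n
    using is_densityD(2)[OF d] is_densityD(2)[OF \<mu>] by (auto simp: set_integrable_def)
  have "(\<lambda>n. \<integral>\<^sup>+ x. norm (?F n x - ?f x) \<partial>lebesgue) \<longlonglongrightarrow> 0"
    by (rule Scheffe_lemma2) (use int ae norm1[OF d] norm1[OF \<mu>] in auto)
  moreover have "(\<integral>\<^sup>+ x. norm (?F n x - ?f x) \<partial>lebesgue)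
      = ennreal (LINT t:{0..}|lebesgue. \<bar>cell_avg \<mu> (Suc n) t - \<mu> t\<bar>)" for n
  proof -
    have "(\<integral>\<^sup>+ x. norm (?F n x - ?f x) \<partial>lebesgue) = ennreal (LINT x|lebesgue. norm (?F n x - ?f x))"
      using int by (intro nn_integral_eq_integral) auto
    also have "(LINT x|lebesgue. norm (?F n x - ?f x)) = (LINT t:{0..}|lebesgue. \<bar>cell_avg \<mu> (Suc n) t - \<mu> t\<bar>)"
      unfolding set_lebesgue_integral_def
      by (intro Bochner_Integration.integral_cong) (auto simp: indicator_def)
    finally show ?thesis .
  qed
  ultimately have "(\<lambda>n. ennreal (LINT t:{0..}|lebesgue. \<bar>cell_avg \<mu> (Suc n) t - \<mu> t\<bar>)) \<longlonglongrightarrow> 0"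
    by simp
  then have "\<forall>\<^sub>F n in sequentially. ennreal (LINT t:{0..}|lebesgue. \<bar>cell_avg \<mu> (Suc n) t - \<mu> t\<bar>) < ennreal e"
    using \<open>e > 0\<close> by (intro order_tendstoD(2)) auto
  then show ?thesis
    by (rule eventually_mono) (metis ennreal_leI not_le)
qed

context dpp_game
begin

text \<open>Half of the error pays for the mass beyond the \<open>n * n\<close> cells of a step
  approximation, the other half for its L1 distance to \<open>\<mu>\<close>, which bounds the change
  of value at every scale.\<close>

lemma scale_lim_of_unif_avg:
  assumes U: "\<And>\<omega>. 0 \<le> U \<omega> \<and> U \<omega> \<le> 1"
    and lim: "unif_within at_top (\<lambda>T. val g V (unif_avg T)) U 0"
    and \<mu>: "is_density \<mu>" "pw_continuous_pos \<mu>"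
  shows "unif_within (at_right 0) (\<lambda>l. val g V (scale \<mu> l)) U 0"
proof (rule unif_within_0I)
  fix e :: real assume "e > 0"
  have "(\<lambda>n. tail \<mu> (real (Suc n))) \<longlonglongrightarrow> 0"
    by (rule filterlim_compose[OF tail_tendsto_0[OF \<mu>(1)]])
       (rule filterlim_compose[OF filterlim_real_sequentially filterlim_Suc])
  then have "\<forall>\<^sub>F n in sequentially. tail \<mu> (real (Suc n)) < e / 2"
    using \<open>e > 0\<close> by (intro order_tendstoD(2)) auto
  moreover have "\<forall>\<^sub>F n in sequentially. (LINT t:{0..}|lebesgue. \<bar>cell_avg \<mu> (Suc n) t - \<mu> t\<bar>) < e / 2"
    using \<open>e > 0\<close> \<mu> by (intro cell_avg_L1) auto
  ultimately have "\<forall>\<^sub>F n in sequentially. tail \<mu> (real (Suc n)) < e / 2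
      \<and> (LINT t:{0..}|lebesgue. \<bar>cell_avg \<mu> (Suc n) t - \<mu> t\<bar>) < e / 2"
    by (rule eventually_conj)
  then obtain i where i: "tail \<mu> (real (Suc i)) < e / 2"
    "(LINT t:{0..}|lebesgue. \<bar>cell_avg \<mu> (Suc i) t - \<mu> t\<bar>) < e / 2"
    using eventually_happens trivial_limit_sequentially by blast
  define n where "n = Suc i"
  define \<nu> where "\<nu> = cell_avg \<mu> n"
  have n: "n > 0" by (simp add: n_def)
  have \<nu>: "is_density \<nu>" using is_density_cell_avg[OF \<mu>(1) n] by (simp add: \<nu>_def)
  have "\<exists>c. \<forall>t\<in>{real k * (1 / real n)..<real (Suc k) * (1 / real n)}. \<nu> t = c" if "k < n * n" for k
    using cell_avg_on_cell[OF \<mu>(1) n that] by (auto simp: \<nu>_def)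
  then have "unif_within (at_right 0) (\<lambda>l. val g V (scale \<nu> l)) U (tail \<nu> (real (n * n) * (1 / real n)))"
    using n by (intro step_density_within[OF U lim] \<nu>) auto
  moreover have "real (n * n) * (1 / real n) = real n" using n by simp
  moreover have "tail \<nu> (real n) \<le> e / 2"
    using i(1) tail_cell_avg[OF \<mu>(1) n] by (simp only: \<nu>_def n_def)
  ultimately have w: "unif_within (at_right 0) (\<lambda>l. val g V (scale \<nu> l)) U (e / 2)"
    by (metis unif_within_mono)
  have "unif_within (at_right 0) (\<lambda>l. val g V (scale \<mu> l)) U e"
    unfolding unif_within_def
  proof (intro allI impI)
    fix d :: real assume "d > 0"
    from unif_withinD[OF w this] eventually_at_right_less[of 0]
    show "\<forall>\<^sub>F l in at_right 0. \<forall>\<omega>. \<bar>val g V (scale \<mu> l) \<omega> - U \<omega>\<bar> \<le> e + d"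
    proof eventually_elim
      case (elim l)
      show ?case
      proof
        fix \<omega>
        show "\<bar>val g V (scale \<mu> l) \<omega> - U \<omega>\<bar> \<le> e + d"
          using elim(1)[rule_format, of \<omega>] val_scale_L1[OF \<nu> \<mu>(1) elim(2), of \<omega>] i(2)
          unfolding \<nu>_def n_def by linarith
      qed
    qed
  qed
  then show "\<exists>a\<le>e. unif_within (at_right 0) (\<lambda>l. val g V (scale \<mu> l)) U a" by blast
qed

end

section \<open>Exponential and power densities\<close>

text \<open>While mass \<open>h\<close> is used, a decreasing density drops by at most
  \<open>L * h\<close>. For small \<open>h\<close> the time this takes is itself of order
  \<open>h\<close>, and the product of the two is quadratic.\<close>

lemma head_L1_deviation_quadratic:
  assumes \<mu>: "is_density \<mu>" and dec: "\<And>s t. 0 \<le> s \<Longrightarrow> s \<le> t \<Longrightarrow> \<mu> t \<le> \<mu> s"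
    and pos: "\<mu> 0 > 0" and "L \<ge> 0" and lip: "\<And>s. s \<ge> 0 \<Longrightarrow> \<mu> 0 - \<mu> s \<le> L * (1 - tail \<mu> s)"
    and s: "s > 0" "tail \<mu> s = 1 - h"
  shows "(LINT t:{0..s}|lebesgue. \<bar>\<mu> t - h / s\<bar>) \<le> 4 * L / \<mu> 0 * h\<^sup>2"
proof -
  have const: "set_integrable lebesgue {0..s} (\<lambda>t. c)" "(LINT t:{0..s}|lebesgue. c) = c * s" for c :: real
    using s by (auto intro: absolutely_integrable_on_const simp: set_lebesgue_integral_def)
  have i: "set_integrable lebesgue {0..s} \<mu>"
    by (rule density_integrable_on[OF \<mu>]) auto
  have i': "set_integrable lebesgue {0..s} (\<lambda>t. \<bar>\<mu> t - h / s\<bar>)"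
    using i const(1) by (intro set_integrable_abs) auto
  have int: "(LINT t:{0..s}|lebesgue. \<mu> t) = h" using head_eq[OF \<mu>, of s] s by simp
  have h: "0 \<le> h" using tail_le_1[OF \<mu>, of s] s by simp
  have "(LINT t:{0..s}|lebesgue. \<mu> s) \<le> (LINT t:{0..s}|lebesgue. \<mu> t)"
    using dec by (intro set_integral_mono const i) auto
  then have lo: "\<mu> s * s \<le> h" by (simp only: int const)
  have "(LINT t:{0..s}|lebesgue. \<mu> t) \<le> (LINT t:{0..s}|lebesgue. \<mu> 0)"
    using dec by (intro set_integral_mono const i) auto
  then have hi: "h \<le> \<mu> 0 * s" by (simp only: int const)
  show ?thesis
  proof (cases "L * h \<le> \<mu> 0 / 2")
    \<comment> \<open>This threshold keeps the density above \<open>\<mu> 0 / 2\<close> on the head,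
      which forces \<open>s\<close> to be at most \<open>2 * h / \<mu> 0\<close>.\<close>
    case True
    have "\<mu> s \<ge> \<mu> 0 / 2" using lip[of s] s True by simp
    then have "\<mu> 0 / 2 * s \<le> h" using lo s by (meson less_imp_le mult_right_mono order_trans)
    then have sh: "s \<le> 2 * h / \<mu> 0" using pos by (simp add: field_simps)
    \<comment> \<open>Both \<open>\<mu> t\<close> and its mean \<open>h / s\<close> lie between
      \<open>\<mu> s\<close> and \<open>\<mu> 0\<close>, an interval of length at most
      \<open>L * h\<close>.\<close>
    have "\<mu> s \<le> h / s" "h / s \<le> \<mu> 0" using lo hi s by (auto simp: field_simps)
    then have "\<bar>\<mu> t - h / s\<bar> \<le> L * h" if "t \<in> {0..s}" for t
      using dec[of 0 t] dec[of t s] lip[of s] s that by auto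
    then have "(LINT t:{0..s}|lebesgue. \<bar>\<mu> t - h / s\<bar>) \<le> (LINT t:{0..s}|lebesgue. L * h)"
      by (intro set_integral_mono const i') auto
    also have "\<dots> = L * h * s" by (rule const)
    also have "\<dots> \<le> L * h * (2 * h / \<mu> 0)"
      using sh h \<open>L \<ge> 0\<close> by (intro mult_left_mono) auto
    also have "\<dots> = 2 * (L * h * h / \<mu> 0)" by simp
    also have "\<dots> \<le> 4 * (L * h * h / \<mu> 0)"
      using h \<open>L \<ge> 0\<close> pos by (intro mult_right_mono) auto
    finally show ?thesis by (simp add: power2_eq_square)
  next
    \<comment> \<open>For large \<open>h\<close> the trivial bound \<open>2 * h\<close> suffices,
      since \<open>1\<close> is then at most \<open>2 * L * h / \<mu> 0\<close>.\<close>
    case False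
    have "\<bar>\<mu> t - h / s\<bar> \<le> \<mu> t + h / s" if "t \<in> {0..s}" for t
      using is_densityD(1)[OF \<mu>, of t] h s that by (auto simp: abs_le_iff)
    then have "(LINT t:{0..s}|lebesgue. \<bar>\<mu> t - h / s\<bar>) \<le> (LINT t:{0..s}|lebesgue. \<mu> t + h / s)"
      using i const(1) by (intro set_integral_mono i') auto
    also have "\<dots> = 2 * h"
      using i const int s by (subst set_integral_add) auto
    also have "\<dots> \<le> 2 * h * (2 * (L * h) / \<mu> 0)"
    proof -
      have "1 \<le> 2 * (L * h) / \<mu> 0" using False pos by (simp add: field_simps)
      then show ?thesis using h by (intro mult_le_cancel_left1[THEN iffD2]) auto
    qed
    finally show ?thesis by (simp add: power2_eq_square mult_ac)
  qed
qed

lemma is_density_expd: "is_density (expd 1)"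
  and tail_expd: "s \<ge> 0 \<Longrightarrow> tail (expd 1) s = exp (- s)"
proof -
  have lim: "((\<lambda>t::real. exp (- t)) \<longlongrightarrow> 0) at_top"
    by (rule filterlim_compose[OF exp_at_bot filterlim_uminus_at_bot_at_top])
  have D: "((\<lambda>t. exp (- t)) has_real_derivative - expd 1 t) (at t)" for t
    by (auto intro!: derivative_eq_intros simp: expd_def)
  have m: "expd 1 \<in> borel_measurable borel" unfolding expd_def by measurable
  note A = density_antideriv[where F = "\<lambda>t. exp (- t)" and f = "expd 1", OF D _ m _ lim]
  show "is_density (expd 1)" by (rule A(1)) (auto simp: expd_def)
  show "s \<ge> 0 \<Longrightarrow> tail (expd 1) s = exp (- s)" by (rule A(2)) (auto simp: expd_def)
qed

lemma expd_eq_scale: "expd l = scale (expd 1) l"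
  by (simp add: expd_def scale_def)

text \<open>The normal form of power densities up to rescaling; the factor
  \<open>\<gamma> - 1\<close> gives total mass 1 when \<open>\<gamma> > 1\<close>.\<close>

definition power_law :: "real \<Rightarrow> real \<Rightarrow> real" where
  "power_law \<gamma> t = (\<gamma> - 1) * (1 + t) powr (- \<gamma>)"

context
  fixes \<gamma> :: real
  assumes \<gamma>: "\<gamma> > 1"
begin

lemma is_density_power_law: "is_density (power_law \<gamma>)"
  and tail_power_law: "s \<ge> 0 \<Longrightarrow> tail (power_law \<gamma>) s = (1 + s) powr (1 - \<gamma>)"
proof -
  have lim: "((\<lambda>t::real. (1 + t) powr (1 - \<gamma>)) \<longlongrightarrow> 0) at_top"
    using \<gamma> by (intro tendsto_neg_powr filterlim_tendsto_add_at_top[OF tendsto_const] filterlim_ident) auto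
  have D: "((\<lambda>t. (1 + t) powr (1 - \<gamma>)) has_real_derivative - power_law \<gamma> t) (at t)" if "t \<ge> 0" for t
  proof -
    have "((\<lambda>t. (1 + t) powr (1 - \<gamma>)) has_real_derivative (1 - \<gamma>) * (1 + t) powr (1 - \<gamma> - 1) * (0 + 1)) (at t)"
      by (rule DERIV_chain2[OF has_real_derivative_powr]) (use that in \<open>auto intro!: derivative_eq_intros\<close>)
    moreover have "(1 - \<gamma>) * (1 + t) powr (1 - \<gamma> - 1) * (0 + 1) = - power_law \<gamma> t"
      by (simp add: power_law_def algebra_simps)
    ultimately show ?thesis by simp
  qed
  have m: "power_law \<gamma> \<in> borel_measurable borel" unfolding power_law_def[abs_def] by measurable
  note A = density_antideriv[where F = "\<lambda>t. (1 + t) powr (1 - \<gamma>)" and f = "power_law \<gamma>", OF D _ m _ lim]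
  show "is_density (power_law \<gamma>)"
    by (rule A(1)) (use \<gamma> in \<open>auto simp: power_law_def\<close>)
  show "s \<ge> 0 \<Longrightarrow> tail (power_law \<gamma>) s = (1 + s) powr (1 - \<gamma>)"
    by (rule A(2)) (use \<gamma> in \<open>auto simp: power_law_def\<close>)
qed

text \<open>Self-similarity rests on \<open>1 + s + t = (1 + s) * (1 + t / (1 + s))\<close> and
  multiplicativity of powers.\<close>

lemma shift_power_law:
  assumes "s \<ge> 0" "t \<ge> 0"
  shows "shift (power_law \<gamma>) s t = scale (power_law \<gamma>) (1 / (1 + s)) t"
proof -
  have "(1 + s) * (1 + 1 / (1 + s) * t) = 1 + (t + s)" using assms by (simp add: field_simps)
  then have "(1 + (t + s)) powr (- \<gamma>) = (1 + s) powr (- \<gamma>) * (1 + 1 / (1 + s) * t) powr (- \<gamma>)"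
    using assms by (metis powr_mult)
  moreover have "(1 + s) powr (1 - \<gamma>) = (1 + s) powr (- \<gamma>) * (1 + s)"
    using assms by (simp add: powr_diff powr_minus field_simps)
  moreover have "(1 + s) powr (- \<gamma>) > 0" using assms by simp
  ultimately show ?thesis
    using assms by (simp add: shift_def scale_def tail_power_law power_law_def)
qed

lemma power_law_decreasing: "0 \<le> s \<Longrightarrow> s \<le> t \<Longrightarrow> power_law \<gamma> t \<le> power_law \<gamma> s"
  using \<gamma> unfolding power_law_def by (intro mult_left_mono powr_mono2') auto

text \<open>With \<open>w\<close> the tail at \<open>s\<close>, the power
  \<open>(1 + s) powr (- \<gamma>)\<close> is \<open>w\<close> to the exponent
  \<open>\<gamma> / (\<gamma> - 1)\<close>. Raising that exponent to an integer \<open>m\<close>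
  lets Bernoulli's inequality bound the drop linearly in \<open>1 - w\<close>.\<close>

lemma power_law_drop_le:
  "\<exists>L\<ge>0. \<forall>s\<ge>0. power_law \<gamma> 0 - power_law \<gamma> s \<le> L * (1 - tail (power_law \<gamma>) s)"
proof -
  obtain m :: nat where m: "\<gamma> / (\<gamma> - 1) \<le> real m" using real_arch_simple by blast
  then have m': "(1 - \<gamma>) * real m \<le> - \<gamma>" using \<gamma> by (simp add: field_simps)
  have "power_law \<gamma> 0 - power_law \<gamma> s \<le> (\<gamma> - 1) * real m * (1 - tail (power_law \<gamma>) s)" if "s \<ge> 0" for s
  proof -
    define w where "w = (1 + s) powr (1 - \<gamma>)"
    have "w \<ge> 0" by (simp add: w_def)
    then have "1 + real m * (w - 1) \<le> (1 + (w - 1)) ^ m"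
      by (intro Bernoulli_inequality) auto
    also have "\<dots> = (1 + s) powr ((1 - \<gamma>) * real m)"
      using that by (simp add: w_def powr_powr powr_realpow[symmetric])
    also have "\<dots> \<le> (1 + s) powr (- \<gamma>)" using m' that by (intro powr_mono) auto
    finally have "(\<gamma> - 1) * (1 - (1 + s) powr (- \<gamma>)) \<le> (\<gamma> - 1) * (real m * (1 - w))"
      using \<gamma> by (intro mult_left_mono) (auto simp: algebra_simps)
    then show ?thesis using that by (simp add: power_law_def tail_power_law w_def algebra_simps)
  qed
  then show ?thesis using \<gamma> by (intro exI[of _ "(\<gamma> - 1) * real m"]) auto
qed

end

text \<open>For an exponent at most 1, the mass of \<open>{T..2 * T}\<close> stays above
  \<open>1 / (3 * \<beta>)\<close> for all large \<open>T\<close>, although tails of a density tend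
  to 0.\<close>

lemma power_density_exponent_gt_1:
  assumes d: "is_density \<rho>" and pos: "\<alpha> > 0" "\<beta> > 0" "\<gamma> > 0"
    and \<rho>: "\<And>t. t \<ge> 0 \<Longrightarrow> \<rho> t = (\<alpha> + \<beta> * t) powr (- \<gamma>)"
  shows "\<gamma> > 1"
proof (rule ccontr)
  assume "\<not> \<gamma> > 1"
  then have g: "\<gamma> \<le> 1" by simp
  \<comment> \<open>The threshold \<open>\<alpha> / \<beta>\<close> gives the base at most
    \<open>3 * \<beta> * T\<close>; the threshold \<open>1 / (2 * \<beta>)\<close> gives the base at
    least 1, so powers are monotone in the exponent.\<close>
  have "tail \<rho> T \<ge> 1 / (3 * \<beta>)" if "T \<ge> max (1 / (2 * \<beta>)) (\<alpha> / \<beta>)" for T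
  proof -
    have "T > 0" using that pos by (smt (verit) divide_pos_pos max.bounded_iff)
    have T: "\<beta> * T \<ge> \<alpha>" "2 * \<beta> * T \<ge> 1" using that pos by (auto simp: field_simps)
    have "(\<alpha> + 2 * \<beta> * T) powr (- \<gamma>) \<ge> (\<alpha> + 2 * \<beta> * T) powr (- 1)"
      using T pos g by (intro powr_mono) auto
    also have "(\<alpha> + 2 * \<beta> * T) powr (- 1) = 1 / (\<alpha> + 2 * \<beta> * T)"
      using T pos by (simp add: powr_minus_divide)
    also have "\<dots> \<ge> 1 / (3 * \<beta> * T)"
    proof (rule divide_left_mono)
      show "\<alpha> + 2 * \<beta> * T \<le> 3 * \<beta> * T" using T by linarith
    qed (use T pos \<open>T > 0\<close> in \<open>auto intro!: mult_pos_pos add_pos_pos\<close>)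
    finally have le: "1 / (3 * \<beta> * T) \<le> (\<alpha> + 2 * \<beta> * T) powr (- \<gamma>)" .
    have "\<rho> t \<ge> 1 / (3 * \<beta> * T)" if "t \<in> {T..2 * T}" for t
    proof -
      have "\<alpha> + \<beta> * t \<le> \<alpha> + \<beta> * (2 * T)" using that pos by auto
      then have "(\<alpha> + 2 * \<beta> * T) powr (- \<gamma>) \<le> (\<alpha> + \<beta> * t) powr (- \<gamma>)"
        using that pos \<open>T > 0\<close> by (intro powr_mono2') (auto intro!: add_pos_nonneg)
      then show ?thesis using le \<rho>[of t] that \<open>T > 0\<close> by simp
    qed
    then have "(LINT t:{T..2 * T}|lebesgue. 1 / (3 * \<beta> * T)) \<le> (LINT t:{T..2 * T}|lebesgue. \<rho> t)"
      using \<open>T > 0\<close>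
      by (intro set_integral_mono absolutely_integrable_on_const density_integrable_on[OF d]) auto
    also have "\<dots> \<le> tail \<rho> T"
      unfolding tail_def using \<open>T > 0\<close> is_densityD(1)[OF d]
      by (intro set_integral_nonneg_mono_set density_integrable_on[OF d]) auto
    finally show ?thesis using \<open>T > 0\<close> by (simp add: set_lebesgue_integral_def)
  qed
  then have "\<forall>\<^sub>F T in at_top. 1 / (3 * \<beta>) \<le> tail \<rho> T"
    using eventually_ge_at_top[of "max (1 / (2 * \<beta>)) (\<alpha> / \<beta>)"] by (auto elim!: eventually_mono)
  then have "1 / (3 * \<beta>) \<le> 0"
    using tail_tendsto_0[OF d] by (intro tendsto_lowerbound) auto
  then show False using pos by (simp add: divide_le_0_iff)
qed

text \<open>Factoring out \<open>\<alpha>\<close> shows that the density is proportional to a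
  rescaled \<open>power_law\<close> with \<open>a = \<beta> / \<alpha>\<close>, and equal total mass
  forces the proportionality constant to be 1.\<close>

lemma power_density_shift_eq_scale:
  assumes "power_density \<rho>"
  obtains \<gamma> a where "\<gamma> > 1" "a > 0"
    "\<And>T t. T \<ge> 0 \<Longrightarrow> t \<ge> 0 \<Longrightarrow> shift \<rho> T t = scale (power_law \<gamma>) (a / (1 + a * T)) t"
proof -
  obtain \<alpha> \<beta> \<gamma> where pos: "\<alpha> > 0" "\<beta> > 0" "\<gamma> > 0" and d: "is_density \<rho>"
    and \<rho>: "\<And>t. t \<ge> 0 \<Longrightarrow> \<rho> t = (\<alpha> + \<beta> * t) powr (- \<gamma>)"
    using assms by (auto simp: power_density_def)
  have \<gamma>: "\<gamma> > 1" using power_density_exponent_gt_1[OF d pos \<rho>] .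
  define a where "a = \<beta> / \<alpha>"
  have a: "a > 0" using pos by (simp add: a_def)
  define k where "k = \<alpha> powr (- \<gamma>) / (a * (\<gamma> - 1))"
  let ?\<sigma> = "scale (power_law \<gamma>) a"
  have \<sigma>: "is_density ?\<sigma>" using is_density_scale[OF is_density_power_law[OF \<gamma>] a] .
  have eq: "\<rho> t = k * ?\<sigma> t" if "t \<ge> 0" for t
  proof -
    have "\<alpha> + \<beta> * t = \<alpha> * (1 + a * t)" using pos by (simp add: a_def field_simps)
    then have "\<rho> t = \<alpha> powr (- \<gamma>) * (1 + a * t) powr (- \<gamma>)"
      using \<rho>[OF that] pos a that by (simp add: powr_mult)
    then show ?thesis using \<gamma> a by (simp add: k_def scale_def power_law_def)
  qed
  have "(LINT t:{0..}|lebesgue. \<rho> t) = (LINT t:{0..}|lebesgue. k * ?\<sigma> t)"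
    using eq by (intro set_lebesgue_integral_cong) auto
  then have "k = 1" using d \<sigma> by (simp add: is_densityD)
  with eq have eq: "\<rho> t = ?\<sigma> t" if "t \<ge> 0" for t using that by simp
  show ?thesis
  proof (rule that[OF \<gamma> a])
    fix T t :: real assume T: "T \<ge> 0" "t \<ge> 0"
    have "tail \<rho> T = tail ?\<sigma> T"
      unfolding tail_def using T eq by (intro set_lebesgue_integral_cong) auto
    then have "shift \<rho> T t = shift ?\<sigma> T t" using T by (simp add: shift_def eq)
    also have "\<dots> = scale (shift (power_law \<gamma>) (a * T)) a t" by (simp add: shift_scale[OF a])
    also have "\<dots> = scale (scale (power_law \<gamma>) (1 / (1 + a * T))) a t"
      using T a by (simp add: scale_def[of "shift _ _"] scale_def[of "scale _ _"] shift_power_law[OF \<gamma>])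
    finally show "shift \<rho> T t = scale (power_law \<gamma>) (a / (1 + a * T)) t"
      by (simp add: scale_scale)
  qed
qed

text \<open>Lets the existential condition on power densities follow from the universal one. For
  exponent 2 the factor of \<open>power_law\<close> is 1, so it has the required form with
  \<open>\<alpha> = \<beta> = 1\<close>.\<close>

lemma power_density_exists: "\<exists>\<rho>. power_density \<rho>"
proof
  show "power_density (power_law 2)"
    unfolding power_density_def
    by (intro conjI is_density_power_law exI[of _ 1] exI[of _ 2]) (auto simp: power_law_def)
qed

lemma pw_continuous_pos_if_isCont:
  assumes "\<And>x. x > 0 \<Longrightarrow> isCont f x"
  shows "pw_continuous_pos f"
  unfolding pw_continuous_pos_def
proof (intro conjI allI impI)
  show "\<exists>S. finite S \<and> (\<forall>x\<in>{a..b} - S. isCont f x)" if "0 < a \<and> a < b" for a b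
    using assms that by (intro exI[of _ "{}"]) auto
  show "\<exists>l. (f \<longlongrightarrow> l) (at_left x)" "\<exists>l. (f \<longlongrightarrow> l) (at_right x)" if "0 < x" for x
    using assms[OF that] by (auto simp: isCont_def filterlim_at_split)
qed

section \<open>Equivalence of the limits\<close>

lemma filterlim_shift_scale:
  "a > 0 \<Longrightarrow> filterlim (\<lambda>T. a / (1 + a * T)) (at_right 0) (at_top :: real filter)"
  by (rule filterlim_compose[OF filterlim_divide_at_right_0])
     (auto intro!: filterlim_tendsto_add_at_top[OF tendsto_const] filterlim_cmult_at_top)

lemma pw_continuous_pos_expd: "pw_continuous_pos (expd 1)"
  by (rule pw_continuous_pos_if_isCont) (auto simp: expd_def intro!: continuous_intros)

lemma pw_continuous_pos_power_law: "pw_continuous_pos (power_law \<gamma>)"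
  by (rule pw_continuous_pos_if_isCont) (auto simp: power_law_def[abs_def] intro!: continuous_intros)

text \<open>On the reals \<open>Sup\<close> of a set without upper bound is one fixed unspecified number, so for
  unbounded \<open>U\<close> the predicate \<open>unif_lim\<close> depends neither on the family nor on the filter.\<close>

lemma Sup_not_bdd_above: "\<not> bdd_above X \<Longrightarrow> Sup X = (LEAST z::real. False)"
proof -
  assume "\<not> bdd_above X"
  then have "(\<lambda>z. \<forall>x\<in>X. x \<le> z) = (\<lambda>z. False)" by (simp add: bdd_above_def fun_eq_iff)
  then show ?thesis unfolding Sup_real_def by (rule arg_cong)
qed

lemma unif_lim_unbounded_iff:
  fixes U :: "'w \<Rightarrow> real"
  assumes "\<not> bounded (range U)" "\<forall>\<^sub>F s in F. bounded (range (f s))" "F \<noteq> bot"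
  shows "unif_lim F f U \<longleftrightarrow> (LEAST z::real. False) = 0"
proof -
  have "\<forall>\<^sub>F s in F. (SUP \<omega>. \<bar>f s \<omega> - U \<omega>\<bar>) = (LEAST z::real. False)"
    using assms(2)
  proof eventually_elim
    case (elim s)
    have "\<not> bdd_above (range (\<lambda>\<omega>. \<bar>f s \<omega> - U \<omega>\<bar>))"
    proof
      assume "bdd_above (range (\<lambda>\<omega>. \<bar>f s \<omega> - U \<omega>\<bar>))"
      then obtain b where b: "\<And>\<omega>. \<bar>f s \<omega> - U \<omega>\<bar> \<le> b" by (auto simp: bdd_above_def)
      obtain a where a: "\<forall>x\<in>range (f s). norm x \<le> a" using elim unfolding bounded_iff by blast
      have "norm (U \<omega>) \<le> a + b" for \<omega>
        using a[rule_format, of "f s \<omega>"] b[of \<omega>] by simp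
      then have "bounded (range U)" unfolding bounded_iff by blast
      with assms(1) show False ..
    qed
    then show ?case by (rule Sup_not_bdd_above)
  qed
  then have "unif_lim F f U \<longleftrightarrow> ((\<lambda>_. LEAST z::real. False) \<longlongrightarrow> 0) F"
    unfolding unif_lim_def by (rule filterlim_cong[OF refl refl])
  then show ?thesis using assms(3) by (simp add: tendsto_const_iff)
qed

text \<open>Makes the uniform density an admissible \<open>\<mu>\<close>, so that the condition on
  all rescalings contains the uniform averages.\<close>

lemma pw_continuous_pos_unit: "pw_continuous_pos unit_density"
proof -
  have left: "(unit_density \<longlongrightarrow> (if x \<le> 1 then 1 else 0)) (at_left x)" if "x > 0" for x :: real
    by (rule tendsto_eventually, rule eventually_at_leftI[of "if x \<le> 1 then 0 else 1"])
       (use that in \<open>auto simp: indicator_def split: if_splits\<close>)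
  have right: "(unit_density \<longlongrightarrow> (if x < 1 then 1 else 0)) (at_right x)" if "x > 0" for x :: real
    by (rule tendsto_eventually, rule eventually_at_rightI[of _ "if x < 1 then 1 else x + 1"])
       (use that in \<open>auto simp: indicator_def split: if_splits\<close>)
  have "isCont unit_density x" if "x > 0" "x \<noteq> 1" for x :: real
    using left[OF that(1)] right[OF that(1)] that
    by (auto simp: isCont_def filterlim_at_split split: if_splits)
  then have "\<forall>x\<in>{a..b} - {1}. isCont unit_density x" if "0 < a" for a b :: real
    using that by auto
  then show ?thesis
    unfolding pw_continuous_pos_def using left right by (blast intro: finite.intros)
qed

context dpp_game
begin

lemma bounded_range_val: "is_density \<rho> \<Longrightarrow> bounded (range (val g V \<rho>))"
  using game bounded_cost unfolding game_mapping_def val_def by blast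

lemma
  assumes "is_density \<mu>"
  shows scale_eventually_01: "\<forall>\<^sub>F l in at_right 0. (\<forall>\<omega>. 0 \<le> val g V (scale \<mu> l) \<omega> \<and> val g V (scale \<mu> l) \<omega> \<le> 1)"
    and scale_eventually_bounded: "\<forall>\<^sub>F l in at_right 0. bounded (range (val g V (scale \<mu> l)))"
  using eventually_at_right_less[of 0] val_bounds bounded_range_val is_density_scale[OF assms]
  by (auto elim!: eventually_mono)

lemma unif_avg_as_scale: "\<forall>\<^sub>F T in at_top. val g V (scale unit_density (1 / T)) = val g V (unif_avg T)"
  using eventually_gt_at_top[of 0] by eventually_elim (simp add: unit_density_scale)

lemma shift_as_scale:
  assumes "power_density \<rho>"
  obtains \<gamma> a where "\<gamma> > 1" "a > 0"
    "\<And>T. T \<ge> 0 \<Longrightarrow> val g V (shift \<rho> T) = val g V (scale (power_law \<gamma>) (a / (1 + a * T)))"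
  using power_density_shift_eq_scale[OF assms] val_cong by metis

lemma unif_avg_bounded: "\<forall>\<^sub>F T in at_top. bounded (range (val g V (unif_avg T)))"
  using eventually_gt_at_top[of 0]
  by eventually_elim (simp add: bounded_range_val is_density_unif_avg)

lemma expd_bounded: "\<forall>\<^sub>F l in at_right 0. bounded (range (val g V (expd l)))"
  using scale_eventually_bounded[OF is_density_expd] by (simp flip: expd_eq_scale)

lemma shift_bounds:
  assumes "power_density \<rho>" "T \<ge> 0"
  shows "0 \<le> val g V (shift \<rho> T) \<omega> \<and> val g V (shift \<rho> T) \<omega> \<le> 1"
    "bounded (range (val g V (shift \<rho> T)))"
proof -
  obtain \<gamma> a where s: "\<gamma> > 1" "a > 0"
    "\<And>T. T \<ge> 0 \<Longrightarrow> val g V (shift \<rho> T) = val g V (scale (power_law \<gamma>) (a / (1 + a * T)))"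
    using shift_as_scale[OF assms(1)] by blast
  have "0 < a / (1 + a * T)" using s(2) assms(2) by (intro divide_pos_pos add_pos_nonneg) auto
  then have "is_density (scale (power_law \<gamma>) (a / (1 + a * T)))"
    by (intro is_density_scale is_density_power_law s)
  then show "0 \<le> val g V (shift \<rho> T) \<omega> \<and> val g V (shift \<rho> T) \<omega> \<le> 1"
    "bounded (range (val g V (shift \<rho> T)))"
    using s(3)[OF assms(2)] val_bounds bounded_range_val by auto
qed

lemma shift_bounded:
  "power_density \<rho> \<Longrightarrow> \<forall>\<^sub>F T in at_top. bounded (range (val g V (shift \<rho> T)))"
  using eventually_ge_at_top[of 0] by eventually_elim (simp add: shift_bounds)

section \<open>From each family to the uniform averages and back\<close>

context
  fixes U :: "'w \<Rightarrow> real"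
  assumes U: "\<And>\<omega>. 0 \<le> U \<omega> \<and> U \<omega> \<le> 1"
begin

text \<open>Joins the quadratic head estimate to the iteration over equal pieces, with
  \<open>C = 4 * L / \<mu> 0\<close>. It serves the exponential and the power densities
  alike.\<close>

lemma unif_avg_lim_of_self_similar:
  assumes \<mu>: "is_density \<mu>" and dec: "\<And>s t. 0 \<le> s \<Longrightarrow> s \<le> t \<Longrightarrow> \<mu> t \<le> \<mu> s"
    and pos: "\<mu> 0 > 0" and L: "L \<ge> 0" "\<And>s. s \<ge> 0 \<Longrightarrow> \<mu> 0 - \<mu> s \<le> L * (1 - tail \<mu> s)"
    and self: "\<And>h. 0 < h \<Longrightarrow> h < 1 \<Longrightarrow>
      \<exists>s>0. \<exists>r>0. tail \<mu> s = 1 - h \<and> (\<forall>t\<ge>0. shift \<mu> s t = scale \<mu> r t)"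
    and lim: "unif_within (at_right 0) (\<lambda>l. val g V (scale \<mu> l)) U 0"
  shows "unif_within at_top (\<lambda>T. val g V (unif_avg T)) U 0"
proof (rule unif_avg_within_of_quadratic[OF U])
  show "0 \<le> 4 * L / \<mu> 0" using L(1) pos by simp
  fix h :: real assume h: "0 < h" "h < 1"
  then obtain s r where s: "s > 0" "r > 0" "tail \<mu> s = 1 - h" "\<And>t. t \<ge> 0 \<Longrightarrow> shift \<mu> s t = scale \<mu> r t"
    using self by blast
  show "unif_within at_top (\<lambda>T. V (mixed_payoff U h T)) U (4 * L / \<mu> 0 * h\<^sup>2)"
    by (rule mixed_payoff_within_of_self_similar[OF U \<mu> lim s(1,3) h(2) s(2,4)
          head_L1_deviation_quadratic[OF \<mu> dec pos L s(1,3)]])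
qed

lemma unif_avg_lim_of_expd:
  assumes "unif_within (at_right 0) (\<lambda>l. val g V (expd l)) U 0"
  shows "unif_within at_top (\<lambda>T. val g V (unif_avg T)) U 0"
\<comment> \<open>\<open>L = 1\<close> works because the drop of the exponential density equals the
  mass used.\<close>
proof (rule unif_avg_lim_of_self_similar[OF is_density_expd, of 1])
  show "unif_within (at_right 0) (\<lambda>l. val g V (scale (expd 1) l)) U 0"
    using assms by (simp flip: expd_eq_scale)
  fix h :: real assume h: "0 < h" "h < 1"
  show "\<exists>s>0. \<exists>r>0. tail (expd 1) s = 1 - h \<and> (\<forall>t\<ge>0. shift (expd 1) s t = scale (expd 1) r t)"
  proof (intro exI conjI allI impI)
    \<comment> \<open>The time at which mass \<open>h\<close> is used; by memorylessness the shift
      changes nothing, so \<open>r = 1\<close>.\<close>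
    show "- ln (1 - h) > 0" using h by simp
    then show t: "tail (expd 1) (- ln (1 - h)) = 1 - h" using h by (simp add: tail_expd)
    show "shift (expd 1) (- ln (1 - h)) t = scale (expd 1) 1 t" for t
      using h unfolding shift_def t by (simp add: expd_def scale_def exp_diff exp_minus field_simps)
  qed simp
qed (auto simp: tail_expd, auto simp: expd_def)

lemma unif_avg_lim_of_power_law:
  assumes \<gamma>: "\<gamma> > 1" and lim: "unif_within (at_right 0) (\<lambda>l. val g V (scale (power_law \<gamma>) l)) U 0"
  shows "unif_within at_top (\<lambda>T. val g V (unif_avg T)) U 0"
proof -
  obtain L where L: "L \<ge> 0"
    "\<And>s. s \<ge> 0 \<Longrightarrow> power_law \<gamma> 0 - power_law \<gamma> s \<le> L * (1 - tail (power_law \<gamma>) s)"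
    using power_law_drop_le[OF \<gamma>] by blast
  show ?thesis
  proof (rule unif_avg_lim_of_self_similar[OF is_density_power_law[OF \<gamma>] _ _ L _ lim])
    fix h :: real assume h: "0 < h" "h < 1"
    \<comment> \<open>\<open>x = 1 + s\<close> solves
      \<open>x powr (1 - \<gamma>) = 1 - h\<close>.\<close>
    define x where "x = (1 - h) powr (- 1 / (\<gamma> - 1))"
    have "(1 - h) powr 0 < x"
      unfolding x_def using h \<gamma> by (intro powr_less_mono') auto
    then have x: "x > 1" using h by simp
    show "\<exists>s>0. \<exists>r>0. tail (power_law \<gamma>) s = 1 - h
        \<and> (\<forall>t\<ge>0. shift (power_law \<gamma>) s t = scale (power_law \<gamma>) r t)"
    proof (intro exI conjI allI impI)
      show "x - 1 > 0" "1 / (1 + (x - 1)) > 0" using x by auto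
      have "- 1 / (\<gamma> - 1) * (1 - \<gamma>) = 1" using \<gamma> by (simp add: field_simps)
      then show "tail (power_law \<gamma>) (x - 1) = 1 - h"
        using x h tail_power_law[OF \<gamma>, of "x - 1"] powr_powr[of "1 - h" "- 1 / (\<gamma> - 1)" "1 - \<gamma>"]
        by (simp add: x_def)
      show "shift (power_law \<gamma>) (x - 1) t = scale (power_law \<gamma>) (1 / (1 + (x - 1))) t" if "t \<ge> 0" for t
        using x that by (intro shift_power_law \<gamma>) auto
    qed
  qed (use \<gamma> power_law_decreasing in \<open>auto simp: power_law_def\<close>)
qed

lemma unif_avg_lim_of_shift:
  assumes "power_density \<rho>" and lim: "unif_within at_top (\<lambda>T. val g V (shift \<rho> T)) U 0"
  shows "unif_within at_top (\<lambda>T. val g V (unif_avg T)) U 0"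
proof -
  obtain \<gamma> a where s: "\<gamma> > 1" "a > 0"
    "\<And>T. T \<ge> 0 \<Longrightarrow> val g V (shift \<rho> T) = val g V (scale (power_law \<gamma>) (a / (1 + a * T)))"
    using shift_as_scale[OF assms(1)] by blast
  \<comment> \<open>The map sending \<open>l\<close> to \<open>1 / l - 1 / a\<close> inverts
    \<open>l = a / (1 + a * T)\<close>, so shifts with large \<open>T\<close> account for all small
    scales.\<close>
  have fl: "filterlim (\<lambda>l. - (1 / a) + 1 / l) at_top (at_right 0)"
    by (intro filterlim_tendsto_add_at_top[OF tendsto_const] filterlim_divide_at_top) auto
  have "\<forall>\<^sub>F l in at_right 0. val g V (shift \<rho> (- (1 / a) + 1 / l)) = val g V (scale (power_law \<gamma>) l)"
    using eventually_at_right_less[of 0] fl[unfolded filterlim_at_top, rule_format, of 0]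
  proof eventually_elim
    case (elim l)
    have "a / (1 + a * (- (1 / a) + 1 / l)) = l"
      using elim(1) s(2) by (simp add: field_simps)
    then show ?case using s(3)[OF elim(2)] by simp
  qed
  then have "unif_within (at_right 0) (\<lambda>l. val g V (scale (power_law \<gamma>) l)) U 0"
    by (rule unif_within_cong[OF unif_within_compose[OF lim fl]])
  then show ?thesis by (rule unif_avg_lim_of_power_law[OF s(1)])
qed

lemma shift_lim_of_unif_avg:
  assumes lim: "unif_within at_top (\<lambda>T. val g V (unif_avg T)) U 0" and "power_density \<rho>"
  shows "unif_within at_top (\<lambda>T. val g V (shift \<rho> T)) U 0"
proof -
  obtain \<gamma> a where s: "\<gamma> > 1" "a > 0"
    "\<And>T. T \<ge> 0 \<Longrightarrow> val g V (shift \<rho> T) = val g V (scale (power_law \<gamma>) (a / (1 + a * T)))"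
    using shift_as_scale[OF assms(2)] by blast
  have "unif_within (at_right 0) (\<lambda>l. val g V (scale (power_law \<gamma>) l)) U 0"
    by (rule scale_lim_of_unif_avg[OF U lim is_density_power_law[OF s(1)] pw_continuous_pos_power_law])
  from unif_within_compose[OF this filterlim_shift_scale[OF s(2)]] show ?thesis
    by (rule unif_within_cong) (use eventually_ge_at_top[of 0] in eventually_elim, simp add: s(3))
qed

lemma expd_lim_of_unif_avg:
  assumes lim: "unif_within at_top (\<lambda>T. val g V (unif_avg T)) U 0"
  shows "unif_within (at_right 0) (\<lambda>l. val g V (expd l)) U 0"
  using scale_lim_of_unif_avg[OF U lim is_density_expd pw_continuous_pos_expd] by (simp flip: expd_eq_scale)

lemma unif_avg_lim_of_scale:
  assumes "unif_within (at_right 0) (\<lambda>l. val g V (scale unit_density l)) U 0"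
  shows "unif_within at_top (\<lambda>T. val g V (unif_avg T)) U 0"
  by (rule unif_within_cong[OF unif_within_compose[OF assms] unif_avg_as_scale])
     (simp add: filterlim_divide_at_right_0)

end

end

theorem theorem1:
  fixes K :: "(real \<Rightarrow> 'w) set"
    and g :: "'w \<Rightarrow> real"
    and V :: "((real \<Rightarrow> 'w) \<Rightarrow> real) \<Rightarrow> 'w \<Rightarrow> real"
  assumes K_ne: "K \<noteq> {}"
    and g_range: "\<And>x. 0 \<le> g x \<and> g x \<le> 1"
    and g_meas: "\<And>z. z \<in> K \<Longrightarrow> set_borel_measurable lebesgue {0..} (\<lambda>t. g (z t))"
    and game: "game_mapping K V"
    and dpp: "DPP g V"
  shows
   "(\<forall>U :: 'w \<Rightarrow> real. (\<forall>\<omega>. 0 \<le> U \<omega> \<and> U \<omega> \<le> 1) \<longrightarrow>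
      (let
         cC = (\<forall>\<mu>. is_density \<mu> \<and> pw_continuous_pos \<mu> \<longrightarrow>
                  unif_lim (at_right 0) (\<lambda>l. val g V (scale \<mu> l)) U);
         cU = unif_lim at_top (\<lambda>T. val g V (unif_avg T)) U;
         cE = unif_lim (at_right 0) (\<lambda>l. val g V (expd l)) U;
         cP = (\<exists>\<rho>. power_density \<rho> \<and> unif_lim at_top (\<lambda>T. val g V (shift \<rho> T)) U);
         cQ = (\<forall>\<rho>. power_density \<rho> \<longrightarrow> unif_lim at_top (\<lambda>T. val g V (shift \<rho> T)) U)
       in (cC \<longleftrightarrow> cU) \<and> (cU \<longleftrightarrow> cE) \<and> (cE \<longleftrightarrow> cP) \<and> (cP \<longleftrightarrow> cQ)))
    \<and>
    (\<forall>\<mu> \<rho>. is_density \<mu> \<and> pw_continuous_pos \<mu> \<and> power_density \<rho> \<longrightarrow>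
      ((\<exists>U. unif_lim at_top (\<lambda>T. val g V (unif_avg T)) U) \<or>
       (\<exists>U. unif_lim (at_right 0) (\<lambda>l. val g V (expd l)) U) \<or>
       (\<exists>U. unif_lim at_top (\<lambda>T. val g V (shift \<rho> T)) U)) \<longrightarrow>
      (\<exists>U. unif_lim at_top (\<lambda>T. val g V (unif_avg T)) U \<and>
           unif_lim (at_right 0) (\<lambda>l. val g V (expd l)) U \<and>
           unif_lim at_top (\<lambda>T. val g V (shift \<rho> T)) U \<and>
           unif_lim (at_right 0) (\<lambda>l. val g V (scale \<mu> l)) U \<and>
           (\<forall>\<mu>' \<rho>'. is_density \<mu>' \<and> pw_continuous_pos \<mu>' \<and> power_density \<rho>' \<longrightarrow>
              unif_lim at_top (\<lambda>T. val g V (shift \<rho>' T)) U \<and>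
              unif_lim (at_right 0) (\<lambda>l. val g V (scale \<mu>' l)) U)))"
proof -
  interpret dpp_game K g V
    by unfold_locales (fact g_range g_meas game dpp)+
  note unb = unif_lim_unbounded_iff[OF _ unif_avg_bounded] unif_lim_unbounded_iff[OF _ expd_bounded]
    unif_lim_unbounded_iff[OF _ shift_bounded] unif_lim_unbounded_iff[OF _ scale_eventually_bounded]
  note bnd = unif_lim_iff_unif_within[OF _ unif_avg_bounded] unif_lim_iff_unif_within[OF _ expd_bounded]
    unif_lim_iff_unif_within[OF _ shift_bounded] unif_lim_iff_unif_within[OF _ scale_eventually_bounded]
  let ?U = "\<lambda>U. unif_lim at_top (\<lambda>T. val g V (unif_avg T)) U"
  let ?E = "\<lambda>U. unif_lim (at_right 0) (\<lambda>l. val g V (expd l)) U"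
  let ?S = "\<lambda>\<rho> U. unif_lim at_top (\<lambda>T. val g V (shift \<rho> T)) U"
  let ?C = "\<lambda>\<mu> U. unif_lim (at_right 0) (\<lambda>l. val g V (scale \<mu> l)) U"
  have bdd01: "bounded (range U)" if "\<And>\<omega>. 0 \<le> U \<omega> \<and> U \<omega> \<le> 1" for U :: "'w \<Rightarrow> real"
    by (rule bounded_subset[OF bounded_closed_interval[of 0 1]]) (use that in auto)
  \<comment> \<open>Uniform averages are the hub: every other condition is compared with them, and
    the rescalings lead back through \<open>unit_density\<close>.\<close>
  have equiv: "?E U \<longleftrightarrow> ?U U" "\<And>\<rho>. power_density \<rho> \<Longrightarrow> ?S \<rho> U \<longleftrightarrow> ?U U"
    "\<And>\<mu>. is_density \<mu> \<Longrightarrow> pw_continuous_pos \<mu> \<Longrightarrow> ?U U \<Longrightarrow> ?C \<mu> U" "?C unit_density U \<Longrightarrow> ?U U"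
    if U: "\<And>\<omega>. 0 \<le> U \<omega> \<and> U \<omega> \<le> 1" for U
  proof -
    note b = bnd[OF bdd01[of U, OF U]]
    show "?E U \<longleftrightarrow> ?U U"
      unfolding b(1,2) using unif_avg_lim_of_expd[of U, OF U] expd_lim_of_unif_avg[of U, OF U] by blast
    show "?S \<rho> U \<longleftrightarrow> ?U U" if "power_density \<rho>" for \<rho>
      unfolding b(1) b(3)[OF that]
      using unif_avg_lim_of_shift[of U, OF U that] shift_lim_of_unif_avg[of U, OF U _ that] by blast
    show "?C \<mu> U" if "is_density \<mu>" "pw_continuous_pos \<mu>" "?U U" for \<mu>
      using that(3) scale_lim_of_unif_avg[of U, OF U _ that(1,2)] unfolding b(1) b(4)[OF that(1)] by blast
    show "?C unit_density U \<Longrightarrow> ?U U"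
      using unif_avg_lim_of_scale[of U, OF U] unfolding b(1) b(4)[OF is_density_unit] by blast
  qed
  have part1: "((\<forall>\<mu>. is_density \<mu> \<and> pw_continuous_pos \<mu> \<longrightarrow> ?C \<mu> U) \<longleftrightarrow> ?U U) \<and> (?U U \<longleftrightarrow> ?E U)
      \<and> (?E U \<longleftrightarrow> (\<exists>\<rho>. power_density \<rho> \<and> ?S \<rho> U))
      \<and> ((\<exists>\<rho>. power_density \<rho> \<and> ?S \<rho> U) \<longleftrightarrow> (\<forall>\<rho>. power_density \<rho> \<longrightarrow> ?S \<rho> U))"
    if U: "\<And>\<omega>. 0 \<le> U \<omega> \<and> U \<omega> \<le> 1" for U
    using equiv[of U, OF U] power_density_exists is_density_unit pw_continuous_pos_unit by meson
  have part2: "?U U \<and> ?E U \<and> ?S \<rho> U \<and> ?C \<mu> U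
      \<and> (\<forall>\<mu>' \<rho>'. is_density \<mu>' \<and> pw_continuous_pos \<mu>' \<and> power_density \<rho>' \<longrightarrow> ?S \<rho>' U \<and> ?C \<mu>' U)"
    if lim: "?U U \<or> ?E U \<or> ?S \<rho> U" and \<mu>: "is_density \<mu>" "pw_continuous_pos \<mu>" and \<rho>: "power_density \<rho>"
    for U \<mu> \<rho>
  \<comment> \<open>Here \<open>U\<close> is an arbitrary real function. If it is unbounded, all the
    limit statements reduce to one and the same proposition.\<close>
  proof (cases "bounded (range U)")
    case False
    note u = unb[OF False]
    show ?thesis
      using lim \<rho> \<mu> by (auto simp: u)
  next
    case True
    \<comment> \<open>Whichever limit is given, its approximants eventually take values in
      \<open>[0,1]\<close>, hence so does \<open>U\<close>, and the equivalences apply to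
      it.\<close>
    have "0 \<le> U \<omega> \<and> U \<omega> \<le> 1" for \<omega>
    proof -
      from lim consider "?U U" | "?E U" | "?S \<rho> U" by blast
      then show ?thesis
      proof cases
        case 1
        have "\<forall>\<^sub>F T in at_top. \<forall>\<omega>. 0 \<le> val g V (unif_avg T) \<omega> \<and> val g V (unif_avg T) \<omega> \<le> 1"
          using eventually_gt_at_top[of 0] by eventually_elim (simp add: val_bounds is_density_unif_avg)
        with 1 show ?thesis
          unfolding bnd(1)[OF True] by (intro unif_within_0_limit_bounds) auto
      next
        case 2
        have "\<forall>\<^sub>F l in at_right 0. \<forall>\<omega>. 0 \<le> val g V (expd l) \<omega> \<and> val g V (expd l) \<omega> \<le> 1"
          using scale_eventually_01[OF is_density_expd] by (simp flip: expd_eq_scale)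
        with 2 show ?thesis
          unfolding bnd(2)[OF True] by (intro unif_within_0_limit_bounds) auto
      next
        case 3
        have "\<forall>\<^sub>F T in at_top. \<forall>\<omega>. 0 \<le> val g V (shift \<rho> T) \<omega> \<and> val g V (shift \<rho> T) \<omega> \<le> 1"
          using eventually_ge_at_top[of 0] by eventually_elim (simp add: shift_bounds \<rho>)
        with 3 show ?thesis
          unfolding bnd(3)[OF True \<rho>] by (intro unif_within_0_limit_bounds) auto
      qed
    qed
    note e = equiv[of U, OF this]
    show ?thesis using lim e \<mu> \<rho> by blast
  qed
  show ?thesis
    unfolding Let_def using part1 part2 by (intro conjI allI impI) (blast+)
qed

end
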